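(* Let $(D,\phi)$ be a basic pair for $U$. Then $$K_{D,\phi}=\prod_{\alpha\in D}K_{\alpha,\phi(\alpha)},$$ where the product (of subsets of $U$) can be taken in any order.
   Context: Let $p$ be an odd prime, $q=p^{e}$ ($e\ge 1$), $\mathbb{F}_q$ the field with $q$ elements, $\mathbb{F}_q^{\times}=\mathbb{F}_q\setminus\{0\}$, and $n\ge 1$. Let $G$ be one of $Sp_{2n}(q)$, $O_{2n}(q)$, $O_{2n+1}(q)$; put $m=2n$ in the first two cases and $m=2n+1$ in the third. $U_m(q)$ is the group of unipotent upper-triangular $m\times m$ matrices over $\mathbb{F}_q$, and $U=G\cap U_m(q)$. Explicitly, with $J$ the $n\times n$ matrix with $1$'s on the anti-diagonal and $0$'s elsewhere, $U$ consists of all block matrices $\begin{pmatrix} x & xv & xw\\ 0 & I_r & -v^{T}J\\ 0&0&Jx^{-T}J\end{pmatrix}$ with $x\in U_n(q)$, $v$ an $n\times r$ matrix, $w$ an $n\times n$ matrix over $\mathbb{F}_q$, where: $r=0$ and $Jw^T-wJ=0$ if $G=Sp_{2n}(q)$; $r=0$ and $Jw^T+wJ=0$ if $G=O_{2n}(q)$; $r=1$ and $Jw^T+wJ=-vv^T$ if $G=O_{2n+1}(q)$. Indexing. Rows and columns of $m\times m$ matrices are indexed by $1\prec 2\prec\cdots\prec n\prec 0\prec -n\prec\cdots\prec -2\prec -1$ (index $0$ present only if $G=O_{2n+1}(q)$); $e_{i,j}$ denotes a matrix unit. Roots. $\varepsilon_1,\dots,\varepsilon_n$ are formal independent symbols;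 $\Phi=\{\varepsilon_i\pm\varepsilon_j:1\le i<j\le n\}\cup\Phi'$ with $\Phi'=\{2\varepsilon_i:1\le i\le n\}$ if $G=Sp_{2n}(q)$, $\Phi'=\emptyset$ if $G=O_{2n}(q)$, $\Phi'=\{\varepsilon_i:1\le i\le n\}$ if $G=O_{2n+1}(q)$. For $\alpha\in\Phi$ let $\mathcal{E}(\alpha)$ be: $\{(i,j),(-j,-i)\}$ if $\alpha=\varepsilon_i-\varepsilon_j$; $\{(i,-j),(j,-i)\}$ if $\alpha=\varepsilon_i+\varepsilon_j$ ($i<j$); $\{(i,-i)\}$ if $\alpha=2\varepsilon_i$; $\{(i,0),(0,-i)\}$ if $\alpha=\varepsilon_i$. For $\Psi\subseteq\Phi$, $\mathcal{E}(\Psi)=\bigcup_{\alpha\in\Psi}\mathcal{E}(\alpha)$. Basic pairs. $D\subseteq\Phi$ is basic if $\mathcal{E}(D)$ contains at most one entry from each row and at most one from each column. A basic pair for $U$ is $(D,\phi)$ with $D\subseteq\Phi$ basic (possibly empty) and $\phi:D\to\mathbb{F}_q^\times$ a map. Superclasses. Let $e_\alpha$ be: $e_{i,j}-e_{-j,-i}$ if $\alpha=\varepsilon_i-\varepsilon_j$; $e_{i,-j}+e_{j,-i}$ if $\alpha=\varepsilon_i+\varepsilon_j$ and $G=Sp_{2n}(q)$; $e_{i,-j}-e_{j,-i}$ if $\alpha=\varepsilon_i+\varepsilon_j$ and $G$ is orthogonal; $e_{i,-i}$ if $\alpha=2\varepsilon_i$; $e_{i,0}-e_{0,-i}$ if $\alpha=\varepsilon_i$.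 Put $e_{D,\phi}=\sum_{\alpha\in D}\phi(\alpha)e_\alpha$, $V_{D,\phi}=U_m(q)\,e_{D,\phi}\,U_m(q)$ and $K_{D,\phi}=\{x\in U: x-1\in V_{D,\phi}\}$ (so $K_{D,\phi}=\{1\}$ if $D=\emptyset$; the empty product of subsets is $\{1\}$). The sets $K_{D,\phi}$ are the superclasses of $U$. For $\alpha\in\Phi$ and $s\in\mathbb{F}_q^\times$, $K_{\alpha,s}$ denotes $K_{D,\phi}$ for $D=\{\alpha\}$ and $\phi(\alpha)=s$. *)

theory Defs
  imports
    "Jordan_Normal_Form.Matrix"
    "HOL-Library.Set_Algebras"
    "HOL-Library.Cardinality"
    "HOL-Computational_Algebra.Primes"
begin

(* The three families of groups: Sp is Sp_{2n}(q), O_even is O_{2n}(q), O_odd is O_{2n+1}(q). *)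
datatype family = Sp | O_even | O_odd

fun middle :: "family \<Rightarrow> nat" where
  "middle Sp = 0"
| "middle O_even = 0"
| "middle O_odd = 1"

definition msize :: "family \<Rightarrow> nat \<Rightarrow> nat" where
  "msize G n = n + middle G + n"

definition unitriangular :: "nat \<Rightarrow> 'a::{zero,one} mat set" where
  "unitriangular m = {A \<in> carrier_mat m m. upper_triangular A \<and> (\<forall>i<m. A $$ (i, i) = 1)}"

definition antidiag :: "nat \<Rightarrow> 'a::{zero,one} mat" where
  "antidiag n = mat n n (\<lambda>(i, j). if i + j + 1 = n then 1 else 0)"

fun w_condition :: "family \<Rightarrow> nat \<Rightarrow> 'a::field mat \<Rightarrow> 'a mat \<Rightarrow> bool" where
  "w_condition Sp n v w \<longleftrightarrow>
     antidiag n * transpose_mat w - w * antidiag n = 0\<^sub>m n n"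
| "w_condition O_even n v w \<longleftrightarrow>
     antidiag n * transpose_mat w + w * antidiag n = 0\<^sub>m n n"
| "w_condition O_odd n v w \<longleftrightarrow>
     antidiag n * transpose_mat w + w * antidiag n = - (v * transpose_mat v)"

(* The 3 x 3 block matrix
     x   xv     xw
     0   I_r   -v^T J
     0   0      J y^T J
   with diagonal blocks of sizes n, r, n; below, y is the inverse of x. *)
definition U_block ::
  "nat \<Rightarrow> nat \<Rightarrow> 'a::field mat \<Rightarrow> 'a mat \<Rightarrow> 'a mat \<Rightarrow> 'a mat \<Rightarrow> 'a mat" where
  "U_block n r x y v w =
     four_block_mat
       (four_block_mat x (x * v) (0\<^sub>m r n) (1\<^sub>m r))
       ((x * w) @\<^sub>r (- transpose_mat v * antidiag n))
       (0\<^sub>m n (n + r))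
       (antidiag n * transpose_mat y * antidiag n)"

definition U_group :: "family \<Rightarrow> nat \<Rightarrow> 'a::field mat set" where
  "U_group G n =
     {U_block n (middle G) x y v w | x y v w.
        x \<in> unitriangular n \<and>
        y \<in> carrier_mat n n \<and> inverts_mat x y \<and> inverts_mat y x \<and>
        v \<in> carrier_mat n (middle G) \<and>
        w \<in> carrier_mat n n \<and>
        w_condition G n v w}"

(* The position (from 0) of the index i in the ordering 1, ..., n, 0, -n, ..., -1;
   the index 0 occurs only in the family O_odd. *)
definition pos :: "family \<Rightarrow> nat \<Rightarrow> int \<Rightarrow> nat" where
  "pos G n i =
     (if i > 0 then nat (i - 1) else if i = 0 then n else nat (int (msize G n) + i))"

definition matrix_unit :: "family \<Rightarrow> nat \<Rightarrow> int \<Rightarrow> int \<Rightarrow> 'a::{zero,one} mat" where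
  "matrix_unit G n i j =
     mat (msize G n) (msize G n) (\<lambda>(a, b). if a = pos G n i \<and> b = pos G n j then 1 else 0)"

(* Formal roots: EpsMinus i j, EpsPlus i j, EpsTwo i and Eps i stand for
   eps_i - eps_j, eps_i + eps_j, 2 eps_i and eps_i. Only arguments with i < j are used in the
   first two, so distinct terms stand for distinct roots. *)
datatype eps_root = EpsMinus nat nat | EpsPlus nat nat | EpsTwo nat | Eps nat

fun extra_roots :: "family \<Rightarrow> nat \<Rightarrow> eps_root set" where
  "extra_roots Sp n = {EpsTwo i | i. 1 \<le> i \<and> i \<le> n}"
| "extra_roots O_even n = {}"
| "extra_roots O_odd n = {Eps i | i. 1 \<le> i \<and> i \<le> n}"

definition roots :: "family \<Rightarrow> nat \<Rightarrow> eps_root set" where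
  "roots G n =
     {EpsMinus i j | i j. 1 \<le> i \<and> i < j \<and> j \<le> n} \<union>
     {EpsPlus i j | i j. 1 \<le> i \<and> i < j \<and> j \<le> n} \<union>
     extra_roots G n"

fun entries :: "eps_root \<Rightarrow> (int \<times> int) set" where
  "entries (EpsMinus i j) = {(int i, int j), (- int j, - int i)}"
| "entries (EpsPlus i j) = {(int i, - int j), (int j, - int i)}"
| "entries (EpsTwo i) = {(int i, - int i)}"
| "entries (Eps i) = {(int i, 0), (0, - int i)}"

definition basic :: "family \<Rightarrow> nat \<Rightarrow> eps_root set \<Rightarrow> bool" where
  "basic G n D \<longleftrightarrow>
     D \<subseteq> roots G n \<and>
     inj_on fst (\<Union>\<alpha>\<in>D. entries \<alpha>) \<and> inj_on snd (\<Union>\<alpha>\<in>D. entries \<alpha>)"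

(* Only the values of phi on D matter in a basic pair (D, phi). *)
definition basic_pair :: "family \<Rightarrow> nat \<Rightarrow> eps_root set \<Rightarrow> (eps_root \<Rightarrow> 'a::field) \<Rightarrow> bool" where
  "basic_pair G n D \<phi> \<longleftrightarrow> basic G n D \<and> (\<forall>\<alpha>\<in>D. \<phi> \<alpha> \<noteq> 0)"

fun root_mat :: "family \<Rightarrow> nat \<Rightarrow> eps_root \<Rightarrow> 'a::field mat" where
  "root_mat G n (EpsMinus i j) =
     matrix_unit G n (int i) (int j) - matrix_unit G n (- int j) (- int i)"
| "root_mat G n (EpsPlus i j) =
     (if G = Sp
      then matrix_unit G n (int i) (- int j) + matrix_unit G n (int j) (- int i)
      else matrix_unit G n (int i) (- int j) - matrix_unit G n (int j) (- int i))"
| "root_mat G n (EpsTwo i) = matrix_unit G n (int i) (- int i)"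
| "root_mat G n (Eps i) = matrix_unit G n (int i) 0 - matrix_unit G n 0 (- int i)"

definition e_mat :: "family \<Rightarrow> nat \<Rightarrow> eps_root set \<Rightarrow> (eps_root \<Rightarrow> 'a::field) \<Rightarrow> 'a mat" where
  "e_mat G n D \<phi> =
     mat (msize G n) (msize G n) (\<lambda>ab. \<Sum>\<alpha>\<in>D. \<phi> \<alpha> * root_mat G n \<alpha> $$ ab)"

definition V_set :: "family \<Rightarrow> nat \<Rightarrow> eps_root set \<Rightarrow> (eps_root \<Rightarrow> 'a::field) \<Rightarrow> 'a mat set" where
  "V_set G n D \<phi> =
     {A * e_mat G n D \<phi> * B | A B.
        A \<in> unitriangular (msize G n) \<and> B \<in> unitriangular (msize G n)}"

definition superclass :: "family \<Rightarrow> nat \<Rightarrow> eps_root set \<Rightarrow> (eps_root \<Rightarrow> 'a::field) \<Rightarrow> 'a mat set"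
  where
  "superclass G n D \<phi> = {x \<in> U_group G n. x - 1\<^sub>m (msize G n) \<in> V_set G n D \<phi>}"

definition root_superclass :: "family \<Rightarrow> nat \<Rightarrow> eps_root \<Rightarrow> 'a::field \<Rightarrow> 'a mat set" where
  "root_superclass G n \<alpha> s = superclass G n {\<alpha>} (\<lambda>_. s)"

(* The product X_1 * ... * X_k of sets of m x m matrices; the sets are multiplied with the
   elementwise product of Set_Algebras, and the empty product is {1}. *)
definition set_product :: "nat \<Rightarrow> 'a::field mat set list \<Rightarrow> 'a mat set" where
  "set_product m Xs = foldr (*) Xs {1\<^sub>m m}"

end

theory Submission
  imports Defs "Jordan_Normal_Form.Determinant" "HOL-Number_Theory.Residues"
begin

text \<open>
  Let \<open>\<sigma>\<close> be the adjoint with respect to the form defining \<open>G\<close>, so that \<open>U\<close> consists of the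
  unitriangular \<open>x\<close> with \<open>\<sigma>(x) x = 1\<close>. The substitution \<open>x = 2 h\<^sup>-\<^sup>1 - 1\<close> turns this condition into
  skewness of \<open>z = 2 (1 - h)\<close>, and \<open>x - 1\<close> and \<open>z\<close> differ by a unitriangular factor. A skew matrix
  in \<open>V\<^sub>D = U\<^sub>m e\<^sub>D U\<^sub>m\<close> has the form \<open>\<sigma>(c) e\<^sub>D c\<close>, because unitriangular matrices have odd
  order and therefore square roots among their powers; hence it is a sum of skew matrices, one
  from each \<open>V\<^sub>\<alpha>\<close> with \<open>\<alpha> \<in> D\<close>. Substituting back a single summand gives \<open>y \<in> K\<^sub>\<alpha>\<close> with \<open>x - y \<in> V\<close> for the remaining roots, so that \<open>\<alpha>\<close> can be
  split off from \<open>x\<close> on the left. Conversely, \<open>y z - 1 = (y - 1) + y (z - 1)\<close>, and for a basic \<open>D\<close>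
  the sum of the \<open>V\<^sub>\<alpha>\<close> is contained in \<open>V\<^sub>D\<close>.
\<close>

section \<open>Unitriangular matrices\<close>

lemma mat_mult_assoc:
  "dim_col A = dim_row B \<Longrightarrow> dim_col B = dim_row C \<Longrightarrow>
    A * B * C = A * (B * (C :: 'a :: semiring_0 mat))"
  by (rule assoc_mult_mat) auto

lemma mat_mult_add:
  "dim_col A = dim_row B \<Longrightarrow> dim_row C = dim_row B \<Longrightarrow> dim_col C = dim_col B \<Longrightarrow>
    A * (B + C) = A * B + A * (C :: 'a :: semiring_0 mat)"
  by (rule mult_add_distrib_mat) auto

lemma mat_add_mult:
  "dim_col A = dim_row C \<Longrightarrow> dim_row B = dim_row A \<Longrightarrow> dim_col B = dim_col A \<Longrightarrow>
    (A + B) * C = A * C + B * (C :: 'a :: semiring_0 mat)"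
  by (rule add_mult_distrib_mat) auto

lemma mat_mult_diff:
  "dim_col A = dim_row B \<Longrightarrow> dim_row C = dim_row B \<Longrightarrow> dim_col C = dim_col B \<Longrightarrow>
    A * (B - C) = A * B - A * (C :: 'a :: ring mat)"
  by (rule mult_minus_distrib_mat) auto

lemma mat_diff_mult:
  "dim_col A = dim_row C \<Longrightarrow> dim_row B = dim_row A \<Longrightarrow> dim_col B = dim_col A \<Longrightarrow>
    (A - B) * C = A * C - B * (C :: 'a :: ring mat)"
  by (rule minus_mult_distrib_mat) auto

lemma mat_smult_mult:
  "dim_col A = dim_row B \<Longrightarrow> (c \<cdot>\<^sub>m A) * B = c \<cdot>\<^sub>m (A * (B :: 'a :: comm_semiring_0 mat))"
  by (rule mult_smult_assoc_mat) auto

lemma mat_mult_smult: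
  "dim_col A = dim_row B \<Longrightarrow> A * (c \<cdot>\<^sub>m B) = c \<cdot>\<^sub>m (A * (B :: 'a :: comm_semiring_0 mat))"
  by (rule mult_smult_distrib) auto

lemma mat_one_mult: "dim_row A = m \<Longrightarrow> 1\<^sub>m m * A = (A :: 'a :: semiring_1 mat)"
  by (rule left_mult_one_mat) auto

lemma mat_mult_one: "dim_col A = m \<Longrightarrow> A * 1\<^sub>m m = (A :: 'a :: semiring_1 mat)"
  by (rule right_mult_one_mat) auto

text \<open>Used as rewrite rules, these expand products over sums, move scalars outwards and nest
  products to the right. Their side conditions are equations between dimensions, which follow from
  the dimensions of the single factors.\<close>

lemmas mat_algebra =
  mat_mult_assoc mat_mult_add mat_add_mult mat_mult_diff mat_diff_mult
  mat_smult_mult mat_mult_smult mat_one_mult mat_mult_one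

lemma mat_mult_index:
  "i < dim_row A \<Longrightarrow> j < dim_col B \<Longrightarrow> dim_col A = dim_row B \<Longrightarrow>
    (A * B) $$ (i, j) = (\<Sum>k<dim_row B. A $$ (i, k) * B $$ (k, j))"
  by (simp add: scalar_prod_def lessThan_atLeast0)

lemma finite_carrier_mat: "finite (carrier_mat nr nc :: 'a::finite mat set)"
proof (rule finite_surj)
  show "finite (({..<nr} \<times> {..<nc}) \<rightarrow>\<^sub>E (UNIV :: 'a set))"
    by (simp add: finite_PiE)
  show "carrier_mat nr nc \<subseteq> mat nr nc ` (({..<nr} \<times> {..<nc}) \<rightarrow>\<^sub>E (UNIV :: 'a set))"
  proof
    fix A :: "'a mat"
    assume A: "A \<in> carrier_mat nr nc"
    have "A = mat nr nc (restrict (($$) A) ({..<nr} \<times> {..<nc}))"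
      using A by (intro eq_matI) auto
    moreover have "restrict (($$) A) ({..<nr} \<times> {..<nc}) \<in> ({..<nr} \<times> {..<nc}) \<rightarrow>\<^sub>E UNIV"
      by auto
    ultimately show "A \<in> mat nr nc ` (({..<nr} \<times> {..<nc}) \<rightarrow>\<^sub>E UNIV)"
      by (metis imageI)
  qed
qed

lemma pow_mat_add:
  assumes "A \<in> carrier_mat m m"
  shows "A ^\<^sub>m (i + j) = A ^\<^sub>m i * (A ^\<^sub>m j :: 'a :: semiring_1 mat)"
  using assms
  by (induction j) (simp_all add: mat_algebra)

lemma invertible_det:
  fixes A :: "'a :: field mat"
  assumes "A \<in> carrier_mat m m" "det A \<noteq> 0"
  obtains B where "B \<in> carrier_mat m m" "B * A = 1\<^sub>m m"
  using det_non_zero_imp_unit[OF assms, unfolded Units_def, of "()"]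
  by (auto simp: ring_mat_def)

section \<open>The group of unitriangular matrices\<close>

lemma unitriangularI:
  assumes "A \<in> carrier_mat m m" "\<And>i j. j < i \<Longrightarrow> i < m \<Longrightarrow> A $$ (i, j) = 0"
    "\<And>i. i < m \<Longrightarrow> A $$ (i, i) = 1"
  shows "A \<in> unitriangular m"
  using assms by (auto simp: unitriangular_def)

lemma unitriangularD:
  assumes "A \<in> unitriangular m"
  shows unitriangular_carrier: "A \<in> carrier_mat m m"
    and unitriangular_dim_row: "dim_row A = m"
    and unitriangular_dim_col: "dim_col A = m"
    and unitriangular_below: "\<And>i j. j < i \<Longrightarrow> i < m \<Longrightarrow> A $$ (i, j) = 0"
    and unitriangular_diag: "\<And>i. i < m \<Longrightarrow> A $$ (i, i) = 1"
  using assms by (auto simp: unitriangular_def)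

lemma one_unitriangular: "1\<^sub>m m \<in> unitriangular m"
  by (rule unitriangularI) auto

lemma mult_unitriangular:
  fixes A B :: "'a :: semiring_1 mat"
  assumes A: "A \<in> unitriangular m" and B: "B \<in> unitriangular m"
  shows "A * B \<in> unitriangular m"
proof (rule unitriangularI)
  note [simp] = unitriangularD[OF A] unitriangularD[OF B]
  show "A * B \<in> carrier_mat m m"
    by (rule mult_carrier_mat) auto
  show "(A * B) $$ (i, j) = 0" if "j < i" "i < m" for i j
  proof -
    have "A $$ (i, k) * B $$ (k, j) = 0" if "k < m" for k
      using \<open>j < i\<close> \<open>i < m\<close> that by (cases "k < i") auto
    then show ?thesis
      using that by (subst mat_mult_index) auto
  qed
  show "(A * B) $$ (i, i) = 1" if "i < m" for i
  proof -
    have "A $$ (i, k) * B $$ (k, i) = (if k = i then 1 else 0)" if "k < m" for k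
      using \<open>i < m\<close> that by (cases k i rule: linorder_cases) auto
    then show ?thesis
      using that by (subst mat_mult_index) auto
  qed
qed

lemma pow_unitriangular:
  fixes A :: "'a :: semiring_1 mat"
  assumes "A \<in> unitriangular m"
  shows "A ^\<^sub>m k \<in> unitriangular m"
  using assms
  by (induction k) (simp_all add: one_unitriangular mult_unitriangular unitriangular_dim_row)

text \<open>If \<open>t\<close> is unitriangular with \<open>t\<^sup>2 = 1\<close>, then \<open>(t + 1) (t - 1) = 0\<close>, where \<open>t + 1\<close>
  has determinant a power of \<open>2\<close>.\<close>

lemma unitriangular_involution:
  fixes A :: "'a :: field mat"
  assumes A: "A \<in> unitriangular m" and two: "(2 :: 'a) \<noteq> 0" and sq: "A * A = 1\<^sub>m m"
  shows "A = 1\<^sub>m m"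
proof -
  note [simp] = unitriangularD[OF A]
  have S: "A + 1\<^sub>m m \<in> carrier_mat m m" by simp
  have "upper_triangular (A + 1\<^sub>m m)"
    by (intro upper_triangularI) auto
  then have "det (A + 1\<^sub>m m) = (\<Prod>i = 0..<m. (A + 1\<^sub>m m) $$ (i, i))"
    using S by (subst det_upper_triangular[of _ m]) (auto simp: prod_list_diag_prod)
  also have "\<dots> = (\<Prod>i = 0..<m. 2)"
    by (intro prod.cong) auto
  finally have "det (A + 1\<^sub>m m) \<noteq> 0"
    using two by simp
  then obtain B where B: "B \<in> carrier_mat m m" "B * (A + 1\<^sub>m m) = 1\<^sub>m m"
    using invertible_det[OF S] by blast
  have "(A + 1\<^sub>m m) * (A - 1\<^sub>m m) = 0\<^sub>m m m"
    by (simp add: mat_algebra sq) auto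
  then have "B * (A + 1\<^sub>m m) * (A - 1\<^sub>m m) = 0\<^sub>m m m"
    using B(1) by (subst mat_mult_assoc) auto
  then have *: "A - 1\<^sub>m m = 0\<^sub>m m m"
    using B by (simp add: mat_one_mult)
  have "A $$ (i, j) = 1\<^sub>m m $$ (i, j)" if "i < m" "j < m" for i j
    using arg_cong[OF *, of "\<lambda>X. X $$ (i, j)"] that by simp
  then show ?thesis
    by (intro eq_matI) auto
qed

text \<open>Over a finite field two powers \<open>A^i\<close> and \<open>A^j\<close> with
  \<open>i < j\<close> coincide. The factor \<open>A^i\<close> has determinant 1 and can be
  cancelled, leaving exponent \<open>j - i\<close>.\<close>

lemma unitriangular_finite_order:
  fixes A :: "'a :: {field,finite} mat"
  assumes A: "A \<in> unitriangular m"
  obtains N where "N > 0" "A ^\<^sub>m N = 1\<^sub>m m"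
proof -
  note [simp] = unitriangularD[OF A] unitriangularD[OF pow_unitriangular[OF A]]
  have "range (\<lambda>k::nat. A ^\<^sub>m k) \<subseteq> carrier_mat m m"
    by auto
  then have "finite (range (\<lambda>k::nat. A ^\<^sub>m k))"
    using finite_carrier_mat finite_subset by blast
  then have "\<not> inj (\<lambda>k::nat. A ^\<^sub>m k)"
    using finite_imageD by blast
  then obtain i j where ij: "i < j" "A ^\<^sub>m i = A ^\<^sub>m j"
    by (metis linorder_injI)
  have "det (A ^\<^sub>m i) = (\<Prod>k = 0..<m. (A ^\<^sub>m i) $$ (k, k))"
    using pow_unitriangular[OF A, of i]
    by (subst det_upper_triangular[of _ m]) (auto simp: prod_list_diag_prod unitriangular_def)
  also have "\<dots> = 1"
    by (intro prod.neutral) auto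
  finally obtain B where B: "B \<in> carrier_mat m m" "B * A ^\<^sub>m i = 1\<^sub>m m"
    using invertible_det[of "A ^\<^sub>m i" m] by auto
  have "A ^\<^sub>m i = A ^\<^sub>m i * A ^\<^sub>m (j - i)"
    using ij pow_mat_add[of A m i "j - i"] by simp
  then have "B * A ^\<^sub>m i = B * A ^\<^sub>m i * A ^\<^sub>m (j - i)"
    using B(1) by (subst mat_mult_assoc) auto
  then have "A ^\<^sub>m (j - i) = 1\<^sub>m m"
    using B by (simp add: mat_one_mult)
  then show ?thesis
    using that[of "j - i"] ij by simp
qed

text \<open>If the least exponent were \<open>M + M\<close>, then \<open>A^M\<close> would be an
  involution, hence trivial by \<open>unitriangular_involution\<close>, against minimality. No
  knowledge of the characteristic beyond \<open>2\<close> being nonzero enters.\<close>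

lemma unitriangular_odd_order:
  fixes A :: "'a :: {field,finite} mat"
  assumes A: "A \<in> unitriangular m" and two: "(2 :: 'a) \<noteq> 0"
  obtains N where "odd N" "A ^\<^sub>m N = 1\<^sub>m m"
proof -
  define N where "N = (LEAST N. N > 0 \<and> A ^\<^sub>m N = 1\<^sub>m m)"
  have ex: "\<exists>N. N > 0 \<and> A ^\<^sub>m N = 1\<^sub>m m"
    using unitriangular_finite_order[OF A] by metis
  have N: "N > 0" "A ^\<^sub>m N = 1\<^sub>m m"
    using LeastI_ex[OF ex] unfolding N_def by auto
  have "odd N"
  proof
    assume "even N"
    then obtain M where M: "N = M + M"
      by (metis evenE mult_2)
    have "A ^\<^sub>m M * A ^\<^sub>m M = 1\<^sub>m m"
      using N(2) unfolding M by (simp add: pow_mat_add[OF unitriangular_carrier[OF A]])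
    then have "A ^\<^sub>m M = 1\<^sub>m m"
      using unitriangular_involution[OF pow_unitriangular[OF A] two] by blast
    moreover have "M > 0" "M < N"
      using N(1) M by auto
    ultimately show False
      using not_less_Least[of M "\<lambda>N. N > 0 \<and> A ^\<^sub>m N = 1\<^sub>m m"] unfolding N_def by auto
  qed
  with N that show ?thesis by blast
qed

text \<open>The inverse is itself a power of \<open>A\<close>, so that it is again
  unitriangular.\<close>

lemma unitriangular_inverse:
  fixes A :: "'a :: {field,finite} mat"
  assumes A: "A \<in> unitriangular m"
  obtains B where "B \<in> unitriangular m" "A * B = 1\<^sub>m m" "B * A = 1\<^sub>m m"
proof -
  obtain N where N: "N > 0" "A ^\<^sub>m N = 1\<^sub>m m"
    using unitriangular_finite_order[OF A] .
  then obtain k where k: "N = Suc k"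
    by (cases N) auto
  have "A ^\<^sub>m k * A = 1\<^sub>m m"
    using N k by simp
  moreover from this have "A * A ^\<^sub>m k = 1\<^sub>m m"
    using mat_mult_left_right_inverse unitriangular_carrier[OF A] pow_carrier_mat by blast
  ultimately show ?thesis
    using that pow_unitriangular[OF A] by blast
qed

text \<open>With odd \<open>N\<close> and \<open>A^N = 1\<close>, the exponent
  \<open>k = (N + 1) / 2\<close> works. That the root is a power of \<open>A\<close> matters in
  \<open>skew_orbit\<close>, where it inherits a commutation relation.\<close>

lemma unitriangular_square_root:
  fixes A :: "'a :: {field,finite} mat"
  assumes A: "A \<in> unitriangular m" and two: "(2 :: 'a) \<noteq> 0"
  obtains k where "A ^\<^sub>m k * A ^\<^sub>m k = A"
proof -
  obtain N where N: "odd N" "A ^\<^sub>m N = 1\<^sub>m m"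
    using unitriangular_odd_order[OF A two] .
  then obtain k where k: "N + 1 = k + k"
    by (metis mult_2 odd_even_add odd_one evenE)
  have "A ^\<^sub>m k * A ^\<^sub>m k = A ^\<^sub>m (N + 1)"
    unfolding k by (simp add: pow_mat_add[OF unitriangular_carrier[OF A]])
  also have "\<dots> = A"
    using N unitriangularD[OF A] by (simp add: mat_one_mult)
  finally show ?thesis
    using that by blast
qed

text \<open>Otherwise the characteristic would be 2, and the characteristic divides the number of
  elements.\<close>

lemma two_neq_zero_of_odd_card:
  assumes "odd CARD('a::{field,finite})"
  shows "(2 :: 'a) \<noteq> 0"
proof
  assume "(2 :: 'a) = 0"
  then have "CHAR('a) dvd 2"
    using of_nat_eq_0_iff_char_dvd[of 2, where ?'a = 'a] by simp
  moreover have "CHAR('a) \<noteq> 1"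
    by simp
  ultimately have "CHAR('a) = 2"
    using two_is_prime_nat prime_nat_iff by blast
  then show False
    using CHAR_dvd_CARD[where ?'a = 'a] assms by simp
qed

section \<open>Skew matrices and the Cayley transform\<close>

definition form_sign :: "family \<Rightarrow> nat \<Rightarrow> nat \<Rightarrow> 'a::field" where
  "form_sign G n i = (if G = Sp \<and> n \<le> i then - 1 else 1)"

text \<open>This is \<open>F^-1 A^T F\<close>, where the Gram matrix \<open>F\<close> has the
  entries \<open>form_sign G n i\<close> at the positions \<open>(i, m - 1 - i)\<close> and zeros
  elsewhere: the anti-diagonal matrix in the orthogonal cases, and its alternating variant for
  \<open>Sp\<close>.\<close>

definition form_adjoint :: "family \<Rightarrow> nat \<Rightarrow> 'a::field mat \<Rightarrow> 'a mat" where
  "form_adjoint G n A =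
     mat (msize G n) (msize G n)
       (\<lambda>(i, j). form_sign G n i * form_sign G n j *
          A $$ (msize G n - 1 - j, msize G n - 1 - i))"

lemma form_sign_square [simp]: "form_sign G n i * form_sign G n i = 1"
  by (simp add: form_sign_def)

text \<open>For \<open>Sp\<close> the reflection exchanges the two halves and so flips both signs;
  in the orthogonal cases all signs are 1.\<close>

lemma form_sign_reflect:
  assumes "i < msize G n" "j < msize G n"
  shows "form_sign G n (msize G n - 1 - i) * form_sign G n (msize G n - 1 - j) =
    form_sign G n i * form_sign G n j"
  using assms by (cases G) (auto simp: form_sign_def msize_def)

lemma form_adjoint_dim [simp]:
  "dim_row (form_adjoint G n A) = msize G n" "dim_col (form_adjoint G n A) = msize G n"
  by (simp_all add: form_adjoint_def)

lemma form_adjoint_carrier: "form_adjoint G n A \<in> carrier_mat (msize G n) (msize G n)"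
  by (simp add: form_adjoint_def)

lemma form_adjoint_index:
  "i < msize G n \<Longrightarrow> j < msize G n \<Longrightarrow>
    form_adjoint G n A $$ (i, j) =
      form_sign G n i * form_sign G n j * A $$ (msize G n - 1 - j, msize G n - 1 - i)"
  by (simp add: form_adjoint_def)

lemma form_adjoint_involution:
  assumes "A \<in> carrier_mat (msize G n) (msize G n)"
  shows "form_adjoint G n (form_adjoint G n A) = A"
proof (rule eq_matI)
  fix i j assume ij: "i < dim_row A" "j < dim_col A"
  then have ij': "i < msize G n" "j < msize G n"
    using assms by auto
  have "form_adjoint G n (form_adjoint G n A) $$ (i, j) =
    (form_sign G n i * form_sign G n j) *
    (form_sign G n (msize G n - 1 - j) * form_sign G n (msize G n - 1 - i)) * A $$ (i, j)"
    using ij' by (simp add: form_adjoint_index)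
  also have "\<dots> = (form_sign G n i * form_sign G n i) * (form_sign G n j * form_sign G n j) *
      A $$ (i, j)"
    by (subst form_sign_reflect[OF ij'(2,1)]) (simp only: ac_simps)
  finally show "form_adjoint G n (form_adjoint G n A) $$ (i, j) = A $$ (i, j)"
    by simp
qed (use assms in auto)

lemma form_adjoint_add:
  assumes "A \<in> carrier_mat (msize G n) (msize G n)" "B \<in> carrier_mat (msize G n) (msize G n)"
  shows "form_adjoint G n (A + B) = form_adjoint G n A + form_adjoint G n B"
  using assms by (intro eq_matI) (auto simp: form_adjoint_index algebra_simps)

lemma form_adjoint_diff:
  assumes "A \<in> carrier_mat (msize G n) (msize G n)" "B \<in> carrier_mat (msize G n) (msize G n)"
  shows "form_adjoint G n (A - B) = form_adjoint G n A - form_adjoint G n B"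
  using assms by (intro eq_matI) (auto simp: form_adjoint_index algebra_simps)

lemma form_adjoint_smult:
  assumes "A \<in> carrier_mat (msize G n) (msize G n)"
  shows "form_adjoint G n (c \<cdot>\<^sub>m A) = c \<cdot>\<^sub>m form_adjoint G n A"
  using assms by (intro eq_matI) (auto simp: form_adjoint_index)

lemma form_adjoint_one: "form_adjoint G n (1\<^sub>m (msize G n)) = 1\<^sub>m (msize G n)"
  by (intro eq_matI) (auto simp: form_adjoint_index)

lemma form_adjoint_mult:
  assumes A: "A \<in> carrier_mat (msize G n) (msize G n)"
    and B: "B \<in> carrier_mat (msize G n) (msize G n)"
  shows "form_adjoint G n (A * B) = form_adjoint G n B * form_adjoint G n A"
proof (rule eq_matI)
  let ?m = "msize G n"
  let ?s = "form_sign G n :: nat \<Rightarrow> 'a"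
  fix i j
  assume "i < dim_row (form_adjoint G n B * form_adjoint G n A)"
    "j < dim_col (form_adjoint G n B * form_adjoint G n A)"
  then have ij: "i < ?m" "j < ?m" by auto
  have "form_adjoint G n (A * B) $$ (i, j) =
      ?s i * ?s j * (\<Sum>k<?m. A $$ (?m - 1 - j, k) * B $$ (k, ?m - 1 - i))"
    using A B ij by (simp add: form_adjoint_index mat_mult_index del: index_mult_mat(1))
  also have "(\<Sum>k<?m. A $$ (?m - 1 - j, k) * B $$ (k, ?m - 1 - i)) =
      (\<Sum>k<?m. A $$ (?m - 1 - j, ?m - 1 - k) * B $$ (?m - 1 - k, ?m - 1 - i))"
    by (subst sum.nat_diff_reindex[symmetric]) simp
  \<comment> \<open>The factor \<open>?s k * ?s k = 1\<close> is inserted so that the signs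
    distribute over the two adjoints, with \<open>k\<close> as the common inner index.\<close>
  also have "?s i * ?s j * \<dots> =
      (\<Sum>k<?m. ?s k * ?s k * (?s i * ?s j *
        (A $$ (?m - 1 - j, ?m - 1 - k) * B $$ (?m - 1 - k, ?m - 1 - i))))"
    by (simp add: sum_distrib_left)
  also have "\<dots> = (\<Sum>k<?m. form_adjoint G n B $$ (i, k) * form_adjoint G n A $$ (k, j))"
    using ij by (intro sum.cong refl) (simp add: form_adjoint_index ac_simps)
  also have "\<dots> = (form_adjoint G n B * form_adjoint G n A) $$ (i, j)"
    using ij by (subst mat_mult_index) auto
  finally show "form_adjoint G n (A * B) $$ (i, j) =
      (form_adjoint G n B * form_adjoint G n A) $$ (i, j)" .
qed auto

lemma form_adjoint_unitriangular:
  assumes A: "A \<in> unitriangular (msize G n)"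
  shows "form_adjoint G n A \<in> unitriangular (msize G n)"
  using unitriangularD[OF A]
  by (intro unitriangularI) (auto simp: form_adjoint_index form_adjoint_carrier)

lemma mat_cancel_left:
  assumes "A * B = 1\<^sub>m m" "dim_col A = dim_row B" "dim_col B = dim_row C" "dim_row C = m"
  shows "A * (B * C) = (C :: 'a :: semiring_1 mat)"
  using assms by (simp add: mat_one_mult flip: mat_mult_assoc)

text \<open>Writing \<open>z = a (e d) \<sigma>(a)\<close>, skewness of \<open>z\<close> means \<open>\<sigma>(d) e = e d\<close>. Since \<open>d\<close> has odd
  order, it has a square root \<open>k\<close> among its powers, hence also \<open>\<sigma>(k) e = e k\<close> and
  \<open>e d = \<sigma>(k) e k\<close>.\<close>

lemma skew_orbit:
  fixes e :: "'a :: {field,finite} mat"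
  assumes two: "(2 :: 'a) \<noteq> 0"
    and a: "a \<in> unitriangular (msize G n)" and b: "b \<in> unitriangular (msize G n)"
    and e: "e \<in> carrier_mat (msize G n) (msize G n)" and skew_e: "form_adjoint G n e = - e"
    and skew: "form_adjoint G n (a * e * b) = - (a * e * b)"
  obtains c where "c \<in> unitriangular (msize G n)" "a * e * b = form_adjoint G n c * e * c"
proof -
  let ?m = "msize G n" and ?\<sigma> = "form_adjoint G n"
  note a_dim [simp] = unitriangular_dim_row[OF a] unitriangular_dim_col[OF a]
  note b_dim [simp] = unitriangular_dim_row[OF b] unitriangular_dim_col[OF b]
  have e_dim [simp]: "dim_row e = ?m" "dim_col e = ?m"
    using e by auto
  obtain a' where a': "a' \<in> unitriangular ?m" "a * a' = 1\<^sub>m ?m" "a' * a = 1\<^sub>m ?m"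
    using unitriangular_inverse[OF a] .
  note a'_dim [simp] = unitriangular_dim_row[OF a'(1)] unitriangular_dim_col[OF a'(1)]
  have \<sigma>a: "?\<sigma> a' * ?\<sigma> a = 1\<^sub>m ?m" "?\<sigma> a * ?\<sigma> a' = 1\<^sub>m ?m"
    using a' unitriangular_carrier[OF a] unitriangular_carrier[OF a'(1)]
    by (simp_all add: form_adjoint_one flip: form_adjoint_mult)
  \<comment> \<open>Since \<open>?\<sigma> a'\<close> inverts \<open>?\<sigma> a\<close>, this
    choice gives \<open>b = d * ?\<sigma> a\<close>.\<close>
  define d where "d = b * ?\<sigma> a'"
  have d: "d \<in> unitriangular ?m"
    unfolding d_def by (intro mult_unitriangular b form_adjoint_unitriangular a')
  note d_dim [simp] = unitriangular_dim_row[OF d] unitriangular_dim_col[OF d]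
  have z: "a * e * b = a * (e * d * ?\<sigma> a)"
    unfolding d_def by (simp add: mat_algebra \<sigma>a)
  have "a * (?\<sigma> (e * d) * ?\<sigma> a) = ?\<sigma> (a * (e * d * ?\<sigma> a))"
    using unitriangular_carrier[OF a] unitriangular_carrier[OF d] e form_adjoint_carrier
    by (simp add: form_adjoint_mult[of _ G n] form_adjoint_involution mat_algebra carrier_matI)
  also have "\<dots> = - (a * (e * d * ?\<sigma> a))"
    using skew unfolding z .
  finally have "a' * (a * (?\<sigma> (e * d) * ?\<sigma> a)) * ?\<sigma> a' = a' * (- (a * (e * d * ?\<sigma> a))) * ?\<sigma> a'"
    by simp
  then have "?\<sigma> (e * d) = - (e * d)"
    by (simp add: mat_algebra mat_cancel_left[OF a'(3)] \<sigma>a)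
  moreover have "?\<sigma> (e * d) = - (?\<sigma> d * e)"
    using unitriangular_carrier[OF d] e by (simp add: form_adjoint_mult skew_e)
  ultimately have comm: "?\<sigma> d * e = e * d"
    by simp
  obtain j where j: "d ^\<^sub>m j * d ^\<^sub>m j = d"
    using unitriangular_square_root[OF d two] .
  have pow_comm: "?\<sigma> (d ^\<^sub>m i) * e = e * d ^\<^sub>m i" for i
  proof (induction i)
    case 0
    then show ?case
      by (simp add: form_adjoint_one mat_algebra)
  next
    case (Suc i)
    have "?\<sigma> (d ^\<^sub>m Suc i) * e = ?\<sigma> d * (?\<sigma> (d ^\<^sub>m i) * e)"
      using unitriangular_carrier[OF d] by (simp add: form_adjoint_mult mat_algebra)
    also have "\<dots> = (?\<sigma> d * e) * d ^\<^sub>m i"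
      unfolding Suc by (simp add: mat_algebra)
    \<comment> \<open>Powers grow by multiplication on the right, so the left factor
      \<open>d\<close> is written as a first power and absorbed by
      \<open>pow_mat_add\<close>.\<close>
    also have "\<dots> = e * (d ^\<^sub>m 1 * d ^\<^sub>m i)"
      unfolding comm by (simp add: mat_algebra)
    also have "d ^\<^sub>m 1 * d ^\<^sub>m i = d ^\<^sub>m Suc i"
      by (subst pow_mat_add[OF unitriangular_carrier[OF d], symmetric]) simp
    finally show ?case .
  qed
  define k where "k = d ^\<^sub>m j"
  have k: "k \<in> unitriangular ?m" "k * k = d" "?\<sigma> k * e = e * k"
    using pow_unitriangular[OF d] j pow_comm by (auto simp: k_def)
  note k_dim [simp] = unitriangular_dim_row[OF k(1)] unitriangular_dim_col[OF k(1)]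
  have "a * e * b = a * ((e * k) * (k * ?\<sigma> a))"
    unfolding z k(2)[symmetric] by (simp add: mat_algebra)
  also have "\<dots> = (a * ?\<sigma> k) * e * (k * ?\<sigma> a)"
    unfolding k(3)[symmetric] by (simp add: mat_algebra)
  also have "a * ?\<sigma> k = ?\<sigma> (k * ?\<sigma> a)"
    using unitriangular_carrier[OF a] unitriangular_carrier[OF k(1)] form_adjoint_carrier
    by (simp add: form_adjoint_mult[of _ G n] form_adjoint_involution carrier_matI)
  finally have "a * e * b = ?\<sigma> (k * ?\<sigma> a) * e * (k * ?\<sigma> a)" .
  moreover have "k * ?\<sigma> a \<in> unitriangular ?m"
    by (intro mult_unitriangular k form_adjoint_unitriangular a)
  ultimately show ?thesis
    using that by blast
qed

text \<open>With \<open>P = \<sigma>(g) g\<close>, expanding the product gives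
  \<open>4 P - 2 \<sigma>(g) - 2 g + 1\<close>, so it equals 1 exactly if
  \<open>2 P = \<sigma>(g) + g\<close>. Multiplying by \<open>\<sigma>(h)\<close> on the left and
  \<open>h\<close> on the right turns this into \<open>2 = h + \<sigma>(h)\<close>. Doubles are
  written as sums throughout.\<close>

lemma cayley_isometry:
  fixes g h :: "'a :: field mat"
  assumes two: "(2 :: 'a) \<noteq> 0"
    and g: "g \<in> carrier_mat (msize G n) (msize G n)"
    and h: "h \<in> carrier_mat (msize G n) (msize G n)"
    and gh: "g * h = 1\<^sub>m (msize G n)" and hg: "h * g = 1\<^sub>m (msize G n)"
  shows "form_adjoint G n (g + g - 1\<^sub>m (msize G n)) * (g + g - 1\<^sub>m (msize G n)) = 1\<^sub>m (msize G n)
    \<longleftrightarrow> form_adjoint G n h + h = 1\<^sub>m (msize G n) + 1\<^sub>m (msize G n)"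
proof -
  let ?m = "msize G n" and ?\<sigma> = "form_adjoint G n"
  have dims [simp]: "dim_row g = ?m" "dim_col g = ?m" "dim_row h = ?m" "dim_col h = ?m"
    using g h by auto
  have \<sigma>: "?\<sigma> g * ?\<sigma> h = 1\<^sub>m ?m" "?\<sigma> h * ?\<sigma> g = 1\<^sub>m ?m"
    using g h gh hg by (simp_all add: form_adjoint_one flip: form_adjoint_mult)
  define P where "P = ?\<sigma> g * g"
  have P_dim [simp]: "dim_row P = ?m" "dim_col P = ?m"
    by (simp_all add: P_def)
  have "?\<sigma> (g + g - 1\<^sub>m ?m) * (g + g - 1\<^sub>m ?m) =
      P + P - ?\<sigma> g + (P + P - ?\<sigma> g) - (g + g - 1\<^sub>m ?m)"
    using g unfolding P_def
    by (simp add: form_adjoint_add form_adjoint_diff form_adjoint_one mat_algebra)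
      (rule eq_matI; simp add: algebra_simps)
  also have "\<dots> = 1\<^sub>m ?m \<longleftrightarrow> P + P = ?\<sigma> g + g" (is "?L = _ \<longleftrightarrow> ?R")
  proof
    assume L: "?L = 1\<^sub>m ?m"
    show ?R
    proof (rule eq_matI)
      fix i j assume "i < dim_row (?\<sigma> g + g)" "j < dim_col (?\<sigma> g + g)"
      \<comment> \<open>Entrywise, the isometry equation carries a common factor 2, which can be
        cancelled in this field.\<close>
      then have "2 * (P $$ (i, j) + P $$ (i, j) - (?\<sigma> g $$ (i, j) + g $$ (i, j))) = 0"
        using arg_cong[OF L, of "\<lambda>X. X $$ (i, j)"] by (simp add: algebra_simps)
      then have "P $$ (i, j) + P $$ (i, j) - (?\<sigma> g $$ (i, j) + g $$ (i, j)) = 0"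
        using two by (metis mult_eq_0_iff)
      then show "(P + P) $$ (i, j) = (?\<sigma> g + g) $$ (i, j)"
        using \<open>i < _\<close> \<open>j < _\<close> by simp
    qed auto
  next
    assume R: ?R
    show "?L = 1\<^sub>m ?m"
    proof (rule eq_matI)
      fix i j assume "i < dim_row (1\<^sub>m ?m :: 'a mat)" "j < dim_col (1\<^sub>m ?m :: 'a mat)"
      then show "?L $$ (i, j) = 1\<^sub>m ?m $$ (i, j)"
        using arg_cong[OF R, of "\<lambda>X. X $$ (i, j)"] by (simp add: algebra_simps)
    qed auto
  qed
  also have "P + P = ?\<sigma> g + g \<longleftrightarrow> ?\<sigma> h + h = 1\<^sub>m ?m + 1\<^sub>m ?m"
  proof
    assume "P + P = ?\<sigma> g + g"
    then have "?\<sigma> h * (P + P) * h = ?\<sigma> h * (?\<sigma> g + g) * h"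
      by simp
    then have "1\<^sub>m ?m + 1\<^sub>m ?m = h + ?\<sigma> h"
      by (simp add: P_def mat_algebra \<sigma> gh mat_cancel_left[OF \<sigma>(2)])
    then show "?\<sigma> h + h = 1\<^sub>m ?m + 1\<^sub>m ?m"
      using h form_adjoint_carrier comm_add_mat by metis
  next
    assume "?\<sigma> h + h = 1\<^sub>m ?m + 1\<^sub>m ?m"
    then have "?\<sigma> g * (?\<sigma> h + h) * g = ?\<sigma> g * (1\<^sub>m ?m + 1\<^sub>m ?m) * g"
      by simp
    then have "g + ?\<sigma> g = P + P"
      by (simp add: P_def mat_algebra \<sigma> hg mat_cancel_left[OF \<sigma>(1)])
    then show "P + P = ?\<sigma> g + g"
      using g form_adjoint_carrier comm_add_mat by metis
  qed
  finally show ?thesis .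
qed

text \<open>The product \<open>a e b\<close> is the difference of the unitriangular matrices
  \<open>a (1 + e) b\<close> and \<open>a b\<close>, which agree on and below the diagonal.\<close>

lemma strict_upper_conj:
  fixes e :: "'a :: field mat"
  assumes a: "a \<in> unitriangular m" and b: "b \<in> unitriangular m"
    and e: "e \<in> carrier_mat m m" "\<And>i j. j \<le> i \<Longrightarrow> i < m \<Longrightarrow> e $$ (i, j) = 0"
    and ij: "j \<le> i" "i < m"
  shows "(a * e * b) $$ (i, j) = 0"
proof -
  note [simp] = unitriangularD(2,3)[OF a] unitriangularD(2,3)[OF b]
  have [simp]: "dim_row e = m" "dim_col e = m" using e by auto
  have "1\<^sub>m m + e \<in> unitriangular m"
    using e by (intro unitriangularI) auto
  then have T: "a * (1\<^sub>m m + e) * b \<in> unitriangular m" "a * b \<in> unitriangular m"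
    by (auto intro: mult_unitriangular a b)
  have "a * e * b = a * (1\<^sub>m m + e) * b - a * b"
    by (simp add: mat_algebra) (rule eq_matI; simp)
  then show ?thesis
    using ij unitriangularD[OF T(1)] unitriangularD[OF T(2)]
    by (cases "j = i") (auto simp del: index_mult_mat(1))
qed

text \<open>This is the splitting step at the level of matrices: \<open>e1\<close> stands for the
  root that is split off and \<open>e2\<close> for all the others. Strict triangularity of
  \<open>e1\<close> makes the denominator \<open>h1\<close> of the new Cayley transform
  unitriangular, hence invertible.\<close>

lemma isometry_splitting:
  fixes x e1 e2 :: "'a :: {field,finite} mat"
  assumes two: "(2 :: 'a) \<noteq> 0"
    and x: "x \<in> unitriangular (msize G n)" "form_adjoint G n x * x = 1\<^sub>m (msize G n)"
    and ab: "a \<in> unitriangular (msize G n)" "b \<in> unitriangular (msize G n)"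
    and xab: "x - 1\<^sub>m (msize G n) = a * (e1 + e2) * b"
    and e1: "e1 \<in> carrier_mat (msize G n) (msize G n)" "form_adjoint G n e1 = - e1"
      "\<And>i j. j \<le> i \<Longrightarrow> i < msize G n \<Longrightarrow> e1 $$ (i, j) = 0"
    and e2: "e2 \<in> carrier_mat (msize G n) (msize G n)" "form_adjoint G n e2 = - e2"
  obtains y a1 b1 a2 b2 where
    "y \<in> unitriangular (msize G n)" "form_adjoint G n y * y = 1\<^sub>m (msize G n)"
    "{a1, b1, a2, b2} \<subseteq> unitriangular (msize G n)"
    "y - 1\<^sub>m (msize G n) = a1 * e1 * b1"
    "form_adjoint G n y * x - 1\<^sub>m (msize G n) = a2 * e2 * b2"
proof -
  let ?m = "msize G n" and ?\<sigma> = "form_adjoint G n" and ?half = "inverse 2 :: 'a"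
  have half: "?half * t + ?half * t = t" for t
    using two by (simp add: field_simps)
  note [simp] = unitriangularD[OF x(1)]
  have [simp]: "dim_row e1 = ?m" "dim_col e1 = ?m" "dim_row e2 = ?m" "dim_col e2 = ?m"
    using e1 e2 by auto
  \<comment> \<open>Solves \<open>x = 2 g - 1\<close>; the diagonal entries are
    \<open>(1 + 1) / 2 = 1\<close>.\<close>
  define g where "g = ?half \<cdot>\<^sub>m (x + 1\<^sub>m ?m)"
  have g: "g \<in> unitriangular ?m"
    using half[of 1] unfolding g_def
    by (intro unitriangularI) (auto simp: distrib_left)
  note g_dim [simp] = unitriangular_dim_row[OF g] unitriangular_dim_col[OF g]
  have x_g: "x = g + g - 1\<^sub>m ?m"
    unfolding g_def by (rule eq_matI) (simp_all add: half two)
  obtain h where h: "h \<in> unitriangular ?m" "g * h = 1\<^sub>m ?m" "h * g = 1\<^sub>m ?m"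
    using unitriangular_inverse[OF g] .
  note h_dim [simp] = unitriangular_dim_row[OF h(1)] unitriangular_dim_col[OF h(1)]
  have h_sum: "?\<sigma> h + h = 1\<^sub>m ?m + 1\<^sub>m ?m"
    using cayley_isometry[OF two unitriangular_carrier[OF g] unitriangular_carrier[OF h(1)] h(2,3)]
      x(2) unfolding x_g by blast
  \<comment> \<open>This is \<open>(x - 1) h = (2 g - 2) h = 2 (1 - h)\<close>, with
    \<open>h\<close> absorbed into the right unitriangular factor.\<close>
  define z where "z = a * (e1 + e2) * (b * h)"
  have bh: "b * h \<in> unitriangular ?m"
    by (intro mult_unitriangular ab h)
  have "z = (x - 1\<^sub>m ?m) * h"
    unfolding xab z_def using unitriangularD(2,3)[OF ab(1)] unitriangularD(2,3)[OF ab(2)]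
    by (simp add: mat_mult_assoc)
  also have "\<dots> = (1\<^sub>m ?m - h) + (1\<^sub>m ?m - h)"
    unfolding x_g by (simp add: mat_algebra h) (rule eq_matI; simp)
  finally have z_h: "z = (1\<^sub>m ?m - h) + (1\<^sub>m ?m - h)" .
  have "?\<sigma> z = (1\<^sub>m ?m - ?\<sigma> h) + (1\<^sub>m ?m - ?\<sigma> h)"
    unfolding z_h using unitriangular_carrier[OF h(1)]
    by (simp add: form_adjoint_add form_adjoint_diff form_adjoint_one carrier_matI)
  also have "\<dots> = - z"
  proof (rule eq_matI)
    fix i j assume "i < dim_row (- z)" "j < dim_col (- z)"
    then have ij: "i < ?m" "j < ?m" by (auto simp: z_h)
    have "?\<sigma> h $$ (i, j) = 1\<^sub>m ?m $$ (i, j) + 1\<^sub>m ?m $$ (i, j) - h $$ (i, j)"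
      using arg_cong[OF h_sum, of "\<lambda>X. X $$ (i, j)"] ij
      by (simp add: eq_diff_eq del: index_one_mat(1))
    then show "(1\<^sub>m ?m - ?\<sigma> h + (1\<^sub>m ?m - ?\<sigma> h)) $$ (i, j) = (- z) $$ (i, j)"
      using ij unfolding z_h by (simp del: index_one_mat(1))
  qed (auto simp: z_h)
  finally have skew_z: "?\<sigma> z = - z" .
  have "e1 + e2 \<in> carrier_mat ?m ?m" "?\<sigma> (e1 + e2) = - (e1 + e2)"
    using e1 e2 by (auto simp: form_adjoint_add intro!: eq_matI)
  then obtain c where c: "c \<in> unitriangular ?m" "z = ?\<sigma> c * (e1 + e2) * c"
    using skew_orbit[OF two ab(1) bh] skew_z unfolding z_def by metis
  note c_dim [simp] = unitriangular_dim_row[OF c(1)] unitriangular_dim_col[OF c(1)]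
  have \<sigma>c: "?\<sigma> c \<in> unitriangular ?m"
    by (intro form_adjoint_unitriangular c)
  \<comment> \<open>The congruence form with \<open>?\<sigma> c\<close> and \<open>c\<close> on the
    two sides makes each summand of \<open>z\<close> skew on its own, which
    \<open>a * e1 * (b * h)\<close> need not be.\<close>
  define z1 where "z1 = ?\<sigma> c * e1 * c"
  have z1_dim [simp]: "dim_row z1 = ?m" "dim_col z1 = ?m"
    by (simp_all add: z1_def)
  have z1_skew: "?\<sigma> z1 = - z1"
    unfolding z1_def using unitriangular_carrier[OF c(1)] e1 form_adjoint_carrier
    by (simp add: form_adjoint_mult[of _ G n] form_adjoint_involution mat_algebra carrier_matI)
  have z1_upper: "z1 $$ (i, j) = 0" if "j \<le> i" "i < ?m" for i j
    unfolding z1_def using strict_upper_conj[OF \<sigma>c c(1) e1(1,3) that] .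
  \<comment> \<open>Solves \<open>z1 = 2 (1 - h1)\<close>, the relation between \<open>z\<close> and
    \<open>h\<close>; below, \<open>y = 2 g1 - 1\<close> with \<open>g1\<close> the inverse of
    \<open>h1\<close>.\<close>
  define h1 where "h1 = 1\<^sub>m ?m - ?half \<cdot>\<^sub>m z1"
  have h1: "h1 \<in> unitriangular ?m"
    unfolding h1_def by (intro unitriangularI) (auto simp: z1_upper)
  note h1_dim [simp] = unitriangular_dim_row[OF h1] unitriangular_dim_col[OF h1]
  have z1_h1: "z1 = (1\<^sub>m ?m - h1) + (1\<^sub>m ?m - h1)"
    unfolding h1_def by (rule eq_matI) (simp_all add: half two)
  have "?\<sigma> h1 + h1 = 1\<^sub>m ?m + 1\<^sub>m ?m"
    unfolding h1_def
    by (simp add: form_adjoint_diff form_adjoint_one form_adjoint_smult z1_skew carrier_matI)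
      (rule eq_matI; simp)
  moreover obtain g1 where g1: "g1 \<in> unitriangular ?m" "h1 * g1 = 1\<^sub>m ?m" "g1 * h1 = 1\<^sub>m ?m"
    using unitriangular_inverse[OF h1] .
  note g1_dim [simp] = unitriangular_dim_row[OF g1(1)] unitriangular_dim_col[OF g1(1)]
  define y where "y = g1 + g1 - 1\<^sub>m ?m"
  ultimately have y_iso: "?\<sigma> y * y = 1\<^sub>m ?m"
    unfolding y_def using cayley_isometry[OF two] g1 h1 unitriangular_carrier by blast
  have y: "y \<in> unitriangular ?m"
    unfolding y_def using unitriangularD[OF g1(1)] by (intro unitriangularI) auto
  note y_dim [simp] = unitriangular_dim_row[OF y] unitriangular_dim_col[OF y]
  have "y - 1\<^sub>m ?m = g1 * z1"
    unfolding y_def z1_h1 by (simp add: mat_algebra g1) (rule eq_matI; simp)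
  then have y1: "y - 1\<^sub>m ?m = (g1 * ?\<sigma> c) * e1 * c"
    unfolding z1_def by (simp add: mat_algebra)
  \<comment> \<open>Here \<open>x - y = 2 (g - g1) = 2 g (h1 - h) g1\<close>, and
    \<open>2 (h1 - h) = z - z1\<close>.\<close>
  have "x - y = g * (z - z1) * g1"
    unfolding x_g y_def z_h z1_h1
    by (simp add: mat_algebra g1 h mat_cancel_left[OF h(2)]) (rule eq_matI; simp)
  also have "z - z1 = ?\<sigma> c * e2 * c"
    unfolding c(2) z1_def by (simp add: mat_algebra) (rule eq_matI; simp)
  finally have xy: "x - y = (g * ?\<sigma> c) * e2 * (c * g1)"
    by (simp add: mat_algebra)
  \<comment> \<open>As \<open>?\<sigma> y\<close> inverts \<open>y\<close>, the identity matrix may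
    be replaced by \<open>?\<sigma> y * y\<close>.\<close>
  have "?\<sigma> y * x - 1\<^sub>m ?m = ?\<sigma> y * (x - y)"
    by (simp add: mat_algebra y_iso)
  also have "\<dots> = (?\<sigma> y * (g * ?\<sigma> c)) * e2 * (c * g1)"
    unfolding xy by (simp add: mat_algebra)
  finally have y2: "?\<sigma> y * x - 1\<^sub>m ?m = (?\<sigma> y * (g * ?\<sigma> c)) * e2 * (c * g1)" .
  have "{g1 * ?\<sigma> c, c, ?\<sigma> y * (g * ?\<sigma> c), c * g1} \<subseteq> unitriangular ?m"
    using g1 c g \<sigma>c y by (auto intro!: mult_unitriangular form_adjoint_unitriangular)
  then show ?thesis
    using that[OF y y_iso _ y1 y2] by blast
qed

text \<open>In \<open>u * e\<close> column \<open>k\<close> of \<open>u\<close> matters only if row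
  \<open>k\<close> of \<open>e\<close> is nonzero. So \<open>u\<close> can take its columns from
  \<open>c\<close> where \<open>e2\<close> has nonzero rows and from \<open>a\<close> elsewhere,
  giving \<open>u e1 = a e1\<close> and \<open>u e2 = c e2\<close>. The rows of \<open>w\<close> are
  chosen in the same way from \<open>d\<close> and \<open>b\<close>. Mixing columns or rows of
  unitriangular matrices keeps them unitriangular.\<close>

lemma unitriangular_sum_of_disjoint:
  fixes e1 e2 :: "'a :: field mat"
  assumes "e1 \<in> carrier_mat m m" "e2 \<in> carrier_mat m m"
    and rows: "\<And>i j j'. i < m \<Longrightarrow> j < m \<Longrightarrow> j' < m \<Longrightarrow> e1 $$ (i, j) = 0 \<or> e2 $$ (i, j') = 0"
    and cols: "\<And>i i' j. i < m \<Longrightarrow> i' < m \<Longrightarrow> j < m \<Longrightarrow> e1 $$ (i, j) = 0 \<or> e2 $$ (i', j) = 0"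
    and a: "a \<in> unitriangular m" and b: "b \<in> unitriangular m"
    and c: "c \<in> unitriangular m" and d: "d \<in> unitriangular m"
  obtains u w where "u \<in> unitriangular m" "w \<in> unitriangular m"
    "a * e1 * b + c * e2 * d = u * (e1 + e2) * w"
proof -
  note [simp] = unitriangularD[OF a] unitriangularD[OF b] unitriangularD[OF c] unitriangularD[OF d]
  have [simp]: "dim_row e1 = m" "dim_col e1 = m" "dim_row e2 = m" "dim_col e2 = m"
    using assms(1,2) by auto
  define u where "u = mat m m (\<lambda>(i, k). if \<forall>j<m. e2 $$ (k, j) = 0 then a $$ (i, k) else c $$ (i, k))"
  define w where "w = mat m m (\<lambda>(k, j). if \<forall>i<m. e2 $$ (i, k) = 0 then b $$ (k, j) else d $$ (k, j))"
  have u: "u \<in> unitriangular m" and w: "w \<in> unitriangular m"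
    unfolding u_def w_def by (auto intro!: unitriangularI)
  note [simp] = unitriangularD(2,3)[OF u] unitriangularD(2,3)[OF w]
  have mult_cong: "X * Y = X' * Y'"
    if "X \<in> carrier_mat m m" "X' \<in> carrier_mat m m" "Y \<in> carrier_mat m m" "Y' \<in> carrier_mat m m"
      "\<And>i k j. i < m \<Longrightarrow> k < m \<Longrightarrow> j < m \<Longrightarrow> X $$ (i, k) * Y $$ (k, j) = X' $$ (i, k) * Y' $$ (k, j)"
    for X X' Y Y' :: "'a mat"
  proof (rule eq_matI)
    fix i j assume "i < dim_row (X' * Y')" "j < dim_col (X' * Y')"
    then show "(X * Y) $$ (i, j) = (X' * Y') $$ (i, j)"
      using that by (simp add: mat_mult_index del: index_mult_mat(1))
  qed (use that in auto)
  have "u * e1 = a * e1"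
  proof (rule mult_cong)
    show "u $$ (i, k) * e1 $$ (k, j) = a $$ (i, k) * e1 $$ (k, j)"
      if "i < m" "k < m" "j < m" for i k j
      using that rows[of k j] by (cases "e1 $$ (k, j) = 0") (auto simp: u_def)
  qed (auto intro: carrier_matI)
  moreover have "u * e2 = c * e2"
    by (rule mult_cong) (auto simp: u_def intro: carrier_matI)
  moreover have "e1 * w = e1 * b"
  proof (rule mult_cong)
    show "e1 $$ (i, k) * w $$ (k, j) = e1 $$ (i, k) * b $$ (k, j)"
      if "i < m" "k < m" "j < m" for i k j
      using that cols[of i _ k] by (cases "e1 $$ (i, k) = 0") (auto simp: w_def)
  qed (auto intro: carrier_matI)
  moreover have "e2 * w = e2 * d"
    by (rule mult_cong) (auto simp: w_def intro: carrier_matI)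
  ultimately have "u * (e1 + e2) * w = a * e1 * b + c * e2 * d"
    by (simp add: mat_mult_add mat_add_mult) (simp add: mat_mult_assoc)
  with u w that show ?thesis by metis
qed

section \<open>Root matrices\<close>

text \<open>The signed indices that actually occur. \<open>pos\<close> is defined on all integers,
  but only here is it injective with values below \<open>msize G n\<close>.\<close>

definition indices :: "family \<Rightarrow> nat \<Rightarrow> int set" where
  "indices G n = {i. \<bar>i\<bar> \<le> int n \<and> (i = 0 \<longrightarrow> G = O_odd)}"

lemma pos_less: "i \<in> indices G n \<Longrightarrow> pos G n i < msize G n"
  by (cases G) (auto simp: indices_def pos_def msize_def)

lemma inj_on_pos: "inj_on (pos G n) (indices G n)"
  by (cases G) (auto simp: inj_on_def indices_def pos_def msize_def split: if_splits)

text \<open>Translates negation of signed indices into the reflection of positions on which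
  \<open>form_adjoint\<close> is built.\<close>

lemma pos_uminus: "i \<in> indices G n \<Longrightarrow> pos G n (- i) = msize G n - 1 - pos G n i"
  by (cases G) (auto simp: indices_def pos_def msize_def)

lemma form_sign_pos:
  "i \<in> indices G n \<Longrightarrow> form_sign G n (pos G n i) = (if G = Sp \<and> i < 0 then - 1 else 1)"
  by (cases G) (auto simp: indices_def pos_def msize_def form_sign_def)

section \<open>Matrix units and single roots\<close>

lemma matrix_unit_dim [simp]:
  "dim_row (matrix_unit G n i j) = msize G n" "dim_col (matrix_unit G n i j) = msize G n"
  by (simp_all add: matrix_unit_def)

lemma matrix_unit_index:
  "a < msize G n \<Longrightarrow> b < msize G n \<Longrightarrow>
    matrix_unit G n i j $$ (a, b) = (if a = pos G n i \<and> b = pos G n j then 1 else 0)"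
  by (simp add: matrix_unit_def)

text \<open>Up to sign the adjoint sends position \<open>(i, j)\<close> to \<open>(-j, -i)\<close>;
  the sets \<open>entries\<close> are orbits of this map.\<close>

lemma form_adjoint_matrix_unit:
  assumes "i \<in> indices G n" "j \<in> indices G n"
  shows "form_adjoint G n (matrix_unit G n i j :: 'a::field mat) =
    (form_sign G n (pos G n i) * form_sign G n (pos G n j)) \<cdot>\<^sub>m matrix_unit G n (- j) (- i)"
proof (rule eq_matI)
  let ?m = "msize G n" and ?c = "form_sign G n (pos G n i) * form_sign G n (pos G n j) :: 'a"
  fix a b
  assume "a < dim_row (?c \<cdot>\<^sub>m matrix_unit G n (- j) (- i))"
    "b < dim_col (?c \<cdot>\<^sub>m matrix_unit G n (- j) (- i))"
  then have ab: "a < ?m" "b < ?m" by auto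
  have "?m - 1 - b = pos G n i \<longleftrightarrow> b = pos G n (- i)" "?m - 1 - a = pos G n j \<longleftrightarrow> a = pos G n (- j)"
    using ab pos_less[OF assms(1)] pos_less[OF assms(2)] pos_uminus[OF assms(1)] pos_uminus[OF assms(2)]
    by auto
  moreover have "form_sign G n (pos G n (- j)) * form_sign G n (pos G n (- i)) = ?c"
    using form_sign_reflect[OF pos_less[OF assms(1)] pos_less[OF assms(2)]]
    by (simp add: pos_uminus assms mult.commute)
  ultimately show "form_adjoint G n (matrix_unit G n i j) $$ (a, b) =
      (?c \<cdot>\<^sub>m matrix_unit G n (- j) (- i)) $$ (a, b)"
    using ab by (auto simp: form_adjoint_index matrix_unit_index)
qed auto

lemma entries_indices:
  assumes "\<alpha> \<in> roots G n" "(i, j) \<in> entries \<alpha>"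
  shows "i \<in> indices G n" "j \<in> indices G n"
  using assms by (cases G; auto simp: roots_def indices_def)+

lemma entries_strictly_upper:
  assumes "\<alpha> \<in> roots G n" "(i, j) \<in> entries \<alpha>"
  shows "pos G n i < pos G n j"
  using assms by (cases G) (auto simp: roots_def pos_def msize_def)

lemma entries_disjoint:
  assumes "\<alpha> \<in> roots G n" "\<beta> \<in> roots G n" "\<alpha> \<noteq> \<beta>"
  shows "entries \<alpha> \<inter> entries \<beta> = {}"
  using assms by (cases G) (auto simp: roots_def)

lemma root_mat_dim [simp]:
  "dim_row (root_mat G n \<alpha>) = msize G n" "dim_col (root_mat G n \<alpha>) = msize G n"
  by (cases \<alpha>; simp)+

lemma root_mat_support:
  assumes "a < msize G n" "b < msize G n" "root_mat G n \<alpha> $$ (a, b) \<noteq> 0"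
  obtains i j where "(i, j) \<in> entries \<alpha>" "a = pos G n i" "b = pos G n j"
  using assms by (cases \<alpha>) (auto simp: matrix_unit_index split: if_splits)

text \<open>The signs in \<open>root_mat\<close> are made for this. The adjoint exchanges the two
  matrix units, with sign -1 for \<open>EpsPlus\<close> in \<open>Sp\<close>, where they are added,
  and sign 1 where they are subtracted. \<open>EpsTwo\<close> occurs only for \<open>Sp\<close>, and
  its single unit is negated.\<close>

lemma form_adjoint_root_mat:
  assumes "\<alpha> \<in> roots G n"
  shows "form_adjoint G n (root_mat G n \<alpha>) = - root_mat G n \<alpha>"
proof -
  have idx: "i \<in> indices G n \<and> j \<in> indices G n" if "(i, j) \<in> entries \<alpha>" for i j
    using entries_indices[OF assms that] by blast
  have root: "G = Sp" if "\<alpha> = EpsTwo i" for i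
    using assms that by (cases G) (auto simp: roots_def)
  have root': "G = O_odd" if "\<alpha> = Eps i" for i
    using assms that by (cases G) (auto simp: roots_def)
  have pos: "0 < i \<and> 0 < j" if "\<alpha> = EpsMinus i j \<or> \<alpha> = EpsPlus i j" for i j
    using assms that by (cases G) (auto simp: roots_def)
  have pos': "0 < i" if "\<alpha> = EpsTwo i" for i
    using assms that by (cases G) (auto simp: roots_def)
  show ?thesis
  proof (cases \<alpha>)
    case (EpsMinus i j)
    then show ?thesis
      using idx[of "int i" "int j"] idx[of "- int j" "- int i"] pos
      by (auto simp: form_adjoint_diff carrier_matI form_adjoint_matrix_unit
          form_sign_pos intro!: eq_matI)
  next
    case (EpsPlus i j)
    then show ?thesis
      using idx[of "int i" "- int j"] idx[of "int j" "- int i"] pos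
      by (auto simp: form_adjoint_diff form_adjoint_add carrier_matI form_adjoint_matrix_unit
          form_sign_pos intro!: eq_matI)
  next
    case (EpsTwo i)
    then show ?thesis
      using idx[of "int i" "- int i"] root pos'
      by (auto simp: form_adjoint_matrix_unit form_sign_pos intro!: eq_matI)
  next
    case (Eps i)
    then show ?thesis
      using idx[of "int i" 0] idx[of 0 "- int i"] root'
      by (auto simp: form_adjoint_diff carrier_matI form_adjoint_matrix_unit
          form_sign_pos intro!: eq_matI)
  qed
qed

section \<open>The matrices attached to sets of roots\<close>

lemma e_mat_dim [simp]:
  "dim_row (e_mat G n D \<phi>) = msize G n" "dim_col (e_mat G n D \<phi>) = msize G n"
  by (simp_all add: e_mat_def)

lemma e_mat_carrier: "e_mat G n D \<phi> \<in> carrier_mat (msize G n) (msize G n)"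
  by (simp add: e_mat_def)

lemma e_mat_index:
  "a < msize G n \<Longrightarrow> b < msize G n \<Longrightarrow>
    e_mat G n D \<phi> $$ (a, b) = (\<Sum>\<alpha>\<in>D. \<phi> \<alpha> * root_mat G n \<alpha> $$ (a, b))"
  by (simp add: e_mat_def)

lemma e_mat_empty: "e_mat G n {} \<phi> = 0\<^sub>m (msize G n) (msize G n)"
  by (rule eq_matI) (auto simp: e_mat_index)

lemma e_mat_insert:
  assumes "finite D" "\<alpha> \<notin> D"
  shows "e_mat G n (insert \<alpha> D) \<phi> = e_mat G n {\<alpha>} (\<lambda>_. \<phi> \<alpha>) + e_mat G n D \<phi>"
  using assms by (intro eq_matI) (auto simp: e_mat_index)

lemma e_mat_support:
  fixes \<phi> :: "eps_root \<Rightarrow> 'a::field"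
  assumes "a < msize G n" "b < msize G n" "e_mat G n D \<phi> $$ (a, b) \<noteq> 0"
  obtains \<alpha> i j where "\<alpha> \<in> D" "(i, j) \<in> entries \<alpha>" "a = pos G n i" "b = pos G n j"
proof -
  have "(\<Sum>\<alpha>\<in>D. \<phi> \<alpha> * root_mat G n \<alpha> $$ (a, b)) \<noteq> 0"
    using assms by (simp add: e_mat_index)
  then obtain \<alpha> where "\<alpha> \<in> D" "\<phi> \<alpha> * root_mat G n \<alpha> $$ (a, b) \<noteq> 0"
    by (rule sum.not_neutral_contains_not_neutral)
  moreover from this have "(root_mat G n \<alpha> :: 'a mat) $$ (a, b) \<noteq> 0"
    by auto
  ultimately show ?thesis
    using that root_mat_support[OF assms(1,2)] by metis
qed

lemma e_mat_strictly_upper: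
  assumes "D \<subseteq> roots G n" "b \<le> a" "a < msize G n"
  shows "e_mat G n D \<phi> $$ (a, b) = 0"
proof (rule ccontr)
  assume "e_mat G n D \<phi> $$ (a, b) \<noteq> 0"
  then obtain \<alpha> i j where "\<alpha> \<in> D" "(i, j) \<in> entries \<alpha>" "a = pos G n i" "b = pos G n j"
    using e_mat_support[of a G n b D \<phi>] assms by auto
  then show False
    using entries_strictly_upper[of \<alpha> G n i j] assms by auto
qed

lemma form_adjoint_e_mat:
  assumes "D \<subseteq> roots G n"
  shows "form_adjoint G n (e_mat G n D \<phi>) = - e_mat G n D \<phi>"
proof (rule eq_matI)
  fix a b assume "a < dim_row (- e_mat G n D \<phi>)" "b < dim_col (- e_mat G n D \<phi>)"
  then have ab: "a < msize G n" "b < msize G n" by auto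
  have "form_adjoint G n (e_mat G n D \<phi>) $$ (a, b) =
      (\<Sum>\<alpha>\<in>D. \<phi> \<alpha> * form_adjoint G n (root_mat G n \<alpha>) $$ (a, b))"
    using ab by (simp add: form_adjoint_index e_mat_index sum_distrib_left ac_simps)
  also have "\<dots> = (\<Sum>\<alpha>\<in>D. - (\<phi> \<alpha> * root_mat G n \<alpha> $$ (a, b)))"
    using assms ab by (intro sum.cong refl) (auto simp: form_adjoint_root_mat)
  finally show "form_adjoint G n (e_mat G n D \<phi>) $$ (a, b) = (- e_mat G n D \<phi>) $$ (a, b)"
    using ab by (simp add: e_mat_index sum_negf)
qed auto

text \<open>Two entries of a basic set that share a row or a column coincide, whereas distinct roots
  have disjoint entry sets. This provides the row and column hypotheses of
  \<open>unitriangular_sum_of_disjoint\<close>.\<close>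

lemma e_mat_disjoint_supports:
  assumes basic: "basic G n (insert \<alpha> D)" and "\<alpha> \<notin> D"
  shows "i < msize G n \<Longrightarrow> j < msize G n \<Longrightarrow> j' < msize G n \<Longrightarrow>
      e_mat G n {\<alpha>} \<psi> $$ (i, j) = 0 \<or> e_mat G n D \<phi> $$ (i, j') = 0" (is "PROP ?rows")
    and "i < msize G n \<Longrightarrow> i' < msize G n \<Longrightarrow> j < msize G n \<Longrightarrow>
      e_mat G n {\<alpha>} \<psi> $$ (i, j) = 0 \<or> e_mat G n D \<phi> $$ (i', j) = 0" (is "PROP ?cols")
proof -
  have roots: "\<beta> \<in> roots G n" if "\<beta> \<in> insert \<alpha> D" for \<beta>
    using basic that by (auto simp: basic_def)
  have inj: "inj_on fst (\<Union>\<beta>\<in>insert \<alpha> D. entries \<beta>)" "inj_on snd (\<Union>\<beta>\<in>insert \<alpha> D. entries \<beta>)"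
    using basic by (simp_all add: basic_def)
  have False
    if \<beta>: "\<beta> \<in> D" "(p, q) \<in> entries \<alpha>" "(p', q') \<in> entries \<beta>"
      and eq: "pos G n p = pos G n p' \<or> pos G n q = pos G n q'"
    for \<beta> p q p' q'
  proof -
    have "p \<in> indices G n" "q \<in> indices G n"
      using entries_indices[OF roots \<beta>(2)] by auto
    moreover have "p' \<in> indices G n" "q' \<in> indices G n"
      using entries_indices[OF roots \<beta>(3)] \<beta>(1) by auto
    ultimately have "p = p' \<or> q = q'"
      using eq inj_on_eq_iff[OF inj_on_pos] by blast
    moreover have "(p, q) \<in> (\<Union>\<beta>\<in>insert \<alpha> D. entries \<beta>)" "(p', q') \<in> (\<Union>\<beta>\<in>insert \<alpha> D. entries \<beta>)"
      using \<beta> by blast+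
    ultimately have "(p, q) = (p', q')"
      using inj_onD[OF inj(1), of "(p, q)" "(p', q')"] inj_onD[OF inj(2), of "(p, q)" "(p', q')"]
      by auto
    then show False
      using \<beta> entries_disjoint[of \<alpha> G n \<beta>] roots assms(2) by blast
  qed
  note disjoint = this
  show "PROP ?rows"
    using e_mat_support[of i G n j "{\<alpha>}" \<psi>] e_mat_support[of i G n j' D \<phi>] disjoint
    by (metis singletonD)
  show "PROP ?cols"
    using e_mat_support[of i G n j "{\<alpha>}" \<psi>] e_mat_support[of i' G n j D \<phi>] disjoint
    by (metis singletonD)
qed

section \<open>The group as a group of isometries\<close>

text \<open>Reflection in the anti-diagonal: the unsigned form of \<open>form_adjoint\<close>,
  available for rectangular blocks. On square matrices it is \<open>J A^T J\<close>.\<close>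

definition antitranspose :: "'a mat \<Rightarrow> 'a mat" where
  "antitranspose A = mat (dim_col A) (dim_row A)
     (\<lambda>(i, j). A $$ (dim_row A - 1 - j, dim_col A - 1 - i))"

lemma antitranspose_dim [simp]:
  "dim_row (antitranspose A) = dim_col A" "dim_col (antitranspose A) = dim_row A"
  by (simp_all add: antitranspose_def)

lemma antitranspose_index:
  "i < dim_col A \<Longrightarrow> j < dim_row A \<Longrightarrow>
    antitranspose A $$ (i, j) = A $$ (dim_row A - 1 - j, dim_col A - 1 - i)"
  by (simp add: antitranspose_def)

lemma antitranspose_involution: "antitranspose (antitranspose A) = A"
  by (rule eq_matI) (auto simp: antitranspose_index)

lemma antitranspose_one: "antitranspose (1\<^sub>m k) = 1\<^sub>m k"
  by (rule eq_matI) (auto simp: antitranspose_index)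

lemma antitranspose_uminus: "antitranspose (- A) = - antitranspose A"
  by (rule eq_matI) (auto simp: antitranspose_index)

lemma antitranspose_mult:
  assumes "dim_col A = dim_row B"
  shows "antitranspose (A * B) = antitranspose B * (antitranspose A :: 'a :: comm_semiring_0 mat)"
proof (rule eq_matI)
  fix i j
  assume "i < dim_row (antitranspose B * antitranspose A)"
    "j < dim_col (antitranspose B * antitranspose A)"
  then have ij: "i < dim_col B" "j < dim_row A" by auto
  let ?k = "dim_row B"
  have "antitranspose (A * B) $$ (i, j) =
      (\<Sum>k<?k. A $$ (dim_row A - 1 - j, k) * B $$ (k, dim_col B - 1 - i))"
    using assms ij by (simp add: antitranspose_index mat_mult_index del: index_mult_mat(1))
  also have "\<dots> = (\<Sum>k<?k. A $$ (dim_row A - 1 - j, ?k - 1 - k) *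
      B $$ (?k - 1 - k, dim_col B - 1 - i))"
    by (subst sum.nat_diff_reindex[symmetric]) simp
  also have "\<dots> = (antitranspose B * antitranspose A) $$ (i, j)"
    using assms ij
    by (simp add: antitranspose_index mat_mult_index mult.commute del: index_mult_mat(1))
  finally show "antitranspose (A * B) $$ (i, j) = (antitranspose B * antitranspose A) $$ (i, j)" .
qed auto

section \<open>Multiplication by the anti-diagonal matrix and the condition on
  \<open>w\<close>\<close>

lemma antidiag_dim [simp]: "dim_row (antidiag n) = n" "dim_col (antidiag n) = n"
  by (simp_all add: antidiag_def)

lemma antidiag_mult_index:
  fixes A :: "'a::field mat"
  assumes "dim_row A = n" "i < n" "j < dim_col A"
  shows "(antidiag n * A) $$ (i, j) = A $$ (n - 1 - i, j)"
proof -
  have "(antidiag n * A) $$ (i, j) = (\<Sum>k<n. (if i + k + 1 = n then 1 else 0) * A $$ (k, j))"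
    using assms by (simp add: mat_mult_index antidiag_def del: index_mult_mat(1))
  also have "\<dots> = (\<Sum>k<n. if k = n - 1 - i then A $$ (k, j) else 0)"
    using assms by (intro sum.cong) auto
  finally show ?thesis
    using assms by simp
qed

lemma mult_antidiag_index:
  fixes A :: "'a::field mat"
  assumes "dim_col A = n" "i < dim_row A" "j < n"
  shows "(A * antidiag n) $$ (i, j) = A $$ (i, n - 1 - j)"
proof -
  have "(A * antidiag n) $$ (i, j) = (\<Sum>k<n. A $$ (i, k) * (if k + j + 1 = n then 1 else 0))"
    using assms by (simp add: mat_mult_index antidiag_def del: index_mult_mat(1))
  also have "\<dots> = (\<Sum>k<n. if k = n - 1 - j then A $$ (i, k) else 0)"
    using assms by (intro sum.cong) auto
  finally show ?thesis
    using assms by simp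
qed

lemma antidiag_transpose_antidiag:
  fixes y :: "'a::field mat"
  assumes "y \<in> carrier_mat n n"
  shows "antidiag n * transpose_mat y * antidiag n = antitranspose y"
  using assms
  by (intro eq_matI)
    (auto simp: mult_antidiag_index antidiag_mult_index antitranspose_index simp del: index_mult_mat(1))

text \<open>In general the antitranspose of \<open>v\<close> also reverses the rows of
  \<open>v^T\<close>; with at most one column in \<open>v\<close> there is nothing to
  reverse.\<close>

lemma transpose_antidiag_thin:
  fixes v :: "'a::field mat"
  assumes "v \<in> carrier_mat n r" "r \<le> 1"
  shows "- transpose_mat v * antidiag n = - antitranspose v"
  using assms
  by (intro eq_matI)
    (auto simp: mult_antidiag_index antitranspose_index le_Suc_eq simp del: index_mult_mat(1))

text \<open>The sign by which \<open>form_adjoint\<close> differs from the antitranspose on the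
  upper right block of size \<open>n\<close>.\<close>

definition corner_sign :: "family \<Rightarrow> 'a::field" where
  "corner_sign G = (if G = Sp then - 1 else 1)"

lemma middle_le_1: "middle G \<le> 1"
  by (cases G) auto

text \<open>For \<open>Sp\<close> and \<open>O_even\<close> the matrix \<open>v\<close> has no columns, so that \<open>v * antitranspose v\<close> vanishes.\<close>

lemma w_condition_antitranspose:
  fixes v w :: "'a::field mat"
  assumes v: "v \<in> carrier_mat n (middle G)" and w: "w \<in> carrier_mat n n"
  shows "w_condition G n v w \<longleftrightarrow>
    w + v * antitranspose v + corner_sign G \<cdot>\<^sub>m antitranspose w = 0\<^sub>m n n"
proof -
  let ?c = "corner_sign G :: 'a"
  have [simp]: "dim_row v = n" "dim_col v = middle G" "dim_row w = n" "dim_col w = n"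
    using v w by auto
  define vv where "vv i j = (\<Sum>k<middle G. v $$ (i, k) * v $$ (j, k))" for i j
  have vv: "(v * antitranspose v) $$ (i, j) = vv i (n - 1 - j)" if "i < n" "j < n" for i j
    using that unfolding vv_def
    by (cases G) (simp_all add: mat_mult_index antitranspose_index del: index_mult_mat(1))
  have vv': "(v * transpose_mat v) $$ (i, j) = vv i j" if "i < n" "j < n" for i j
    using that unfolding vv_def by (simp add: mat_mult_index del: index_mult_mat(1))
  have vv_0: "vv i j = 0" if "G \<noteq> O_odd" for i j
    using that unfolding vv_def by (cases G) auto
  have "w_condition G n v w \<longleftrightarrow>
    (\<forall>i<n. \<forall>j<n. w $$ (j, n - 1 - i) + ?c * w $$ (i, n - 1 - j) = - vv i j)"
    using vv_0 vv'
    by (cases G)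
      (auto simp: mat_eq_iff antidiag_mult_index mult_antidiag_index corner_sign_def
        simp del: index_mult_mat(1))
  \<comment> \<open>Replacing \<open>j\<close> by \<open>n - 1 - j\<close> turns the one-sided
    products with \<open>antidiag n\<close> into antitransposes.\<close>
  also have "\<dots> \<longleftrightarrow>
    (\<forall>i<n. \<forall>j<n. w $$ (n - 1 - j, n - 1 - i) + ?c * w $$ (i, j) = - vv i (n - 1 - j))"
    (is "?A \<longleftrightarrow> ?B")
  proof
    assume A: ?A
    show ?B
    proof (intro allI impI)
      fix i j assume "i < n" "j < n"
      then show "w $$ (n - 1 - j, n - 1 - i) + ?c * w $$ (i, j) = - vv i (n - 1 - j)"
        using A[rule_format, of i "n - 1 - j"] by simp
    qed
  next
    assume B: ?B
    show ?A
    proof (intro allI impI)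
      fix i j assume "i < n" "j < n"
      then show "w $$ (j, n - 1 - i) + ?c * w $$ (i, n - 1 - j) = - vv i j"
        using B[rule_format, of i "n - 1 - j"] by simp
    qed
  qed
  also have "\<dots> \<longleftrightarrow>
    (\<forall>i<n. \<forall>j<n. w $$ (i, j) + vv i (n - 1 - j) + ?c * w $$ (n - 1 - j, n - 1 - i) = 0)"
  proof -
    \<comment> \<open>For \<open>Sp\<close> the term \<open>vv i j\<close> vanishes and the two
      sides differ by the factor -1; otherwise this is a rearrangement.\<close>
    have "a + ?c * b = - vv i j \<longleftrightarrow> b + vv i j + ?c * a = 0" for a b i j
    proof (cases "G = Sp")
      case True
      then show ?thesis
        using vv_0[of i j] by (auto simp: corner_sign_def)
    next
      case False
      then show ?thesis
        by (simp add: corner_sign_def eq_neg_iff_add_eq_0 ac_simps)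
    qed
    then show ?thesis by simp
  qed
  also have "\<dots> \<longleftrightarrow> w + v * antitranspose v + ?c \<cdot>\<^sub>m antitranspose w = 0\<^sub>m n n"
    using vv by (simp add: mat_eq_iff antitranspose_index del: index_mult_mat(1))
  finally show ?thesis .
qed

section \<open>Submatrices and block multiplication\<close>

definition block :: "nat \<Rightarrow> nat \<Rightarrow> nat \<Rightarrow> nat \<Rightarrow> 'a mat \<Rightarrow> 'a mat" where
  "block i0 j0 h w X = mat h w (\<lambda>(i, j). X $$ (i0 + i, j0 + j))"

lemma block_dim [simp]: "dim_row (block i0 j0 h w X) = h" "dim_col (block i0 j0 h w X) = w"
  by (simp_all add: block_def)

lemma block_index: "i < h \<Longrightarrow> j < w \<Longrightarrow> block i0 j0 h w X $$ (i, j) = X $$ (i0 + i, j0 + j)"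
  by (simp add: block_def)

lemma sum_lessThan_add:
  "(\<Sum>k<a + b. f k) = (\<Sum>k<a. f k) + (\<Sum>k<b. f (a + k) :: 'a :: comm_monoid_add)" for a b :: nat
  by (induction b) (simp_all add: add.assoc)

lemma block_mult:
  fixes X Y :: "'a::semiring_0 mat"
  assumes "X \<in> carrier_mat (n + r + n) (n + r + n)" "Y \<in> carrier_mat (n + r + n) (n + r + n)"
    and "i0 + h \<le> n + r + n" "j0 + w \<le> n + r + n"
  shows "block i0 j0 h w (X * Y) =
    block i0 0 h n X * block 0 j0 n w Y + block i0 n h r X * block n j0 r w Y
      + block i0 (n + r) h n X * block (n + r) j0 n w Y"
  using assms
  by (intro eq_matI)
    (auto simp: block_index mat_mult_index sum_lessThan_add simp del: index_mult_mat(1))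

lemma block_eqI:
  assumes X: "X \<in> carrier_mat (n + r + n) (n + r + n)" and Y: "Y \<in> carrier_mat (n + r + n) (n + r + n)"
    and blocks: "\<And>i0 h j0 w. (i0, h) \<in> {(0, n), (n, r), (n + r, n)} \<Longrightarrow>
      (j0, w) \<in> {(0, n), (n, r), (n + r, n)} \<Longrightarrow> block i0 j0 h w X = block i0 j0 h w Y"
  shows "X = Y"
proof (rule eq_matI)
  fix i j assume "i < dim_row Y" "j < dim_col Y"
  then have ij: "i < n + r + n" "j < n + r + n" using Y by auto
  have "\<exists>p\<in>{(0, n), (n, r), (n + r, n)}. fst p \<le> k \<and> k < fst p + snd p"
    if "k < n + r + n" for k
    using that by auto
  then have split: "\<exists>k0 l. (k0, l) \<in> {(0, n), (n, r), (n + r, n)} \<and> k0 \<le> k \<and> k < k0 + l"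
    if "k < n + r + n" for k
    using that by (metis prod.collapse)
  obtain i0 h where h: "(i0, h) \<in> {(0, n), (n, r), (n + r, n)}" "i0 \<le> i" "i < i0 + h"
    using split[OF ij(1)] by blast
  obtain j0 w where w: "(j0, w) \<in> {(0, n), (n, r), (n + r, n)}" "j0 \<le> j" "j < j0 + w"
    using split[OF ij(2)] by blast
  have "block i0 j0 h w X $$ (i - i0, j - j0) = block i0 j0 h w Y $$ (i - i0, j - j0)"
    using blocks[OF h(1) w(1)] by simp
  then show "X $$ (i, j) = Y $$ (i, j)"
    using h(2,3) w(2,3) by (subst (asm) (1 2) block_index) auto
qed (use X Y in auto)

lemma block_one:
  "block i0 i0 h h (1\<^sub>m m) = 1\<^sub>m h" if "i0 + h \<le> m"
  using that by (intro eq_matI) (auto simp: block_index)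

lemma block_one_offdiagonal:
  "block i0 j0 h w (1\<^sub>m m) = 0\<^sub>m h w" if "i0 + h \<le> j0 \<or> j0 + w \<le> i0" "i0 + h \<le> m" "j0 + w \<le> m"
  using that by (intro eq_matI) (auto simp: block_index)

text \<open>Here \<open>i1\<close> rows lie below the block and \<open>j1\<close> columns to its
  right. Reflection in the anti-diagonal turns these margins into the row and column offsets of the
  source block in swapped order.\<close>

lemma block_form_adjoint:
  fixes X :: "'a::field mat"
  assumes "i0 + h + i1 = msize G n" "j0 + w + j1 = msize G n"
    and sign: "\<And>i j. i < h \<Longrightarrow> j < w \<Longrightarrow> form_sign G n (i0 + i) * form_sign G n (j0 + j) = (c :: 'a)"
  shows "block i0 j0 h w (form_adjoint G n X) = c \<cdot>\<^sub>m antitranspose (block j1 i1 w h X)"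
proof (rule eq_matI)
  fix i j assume "i < dim_row (c \<cdot>\<^sub>m antitranspose (block j1 i1 w h X))"
    "j < dim_col (c \<cdot>\<^sub>m antitranspose (block j1 i1 w h X))"
  then have ij: "i < h" "j < w" by auto
  have "msize G n - 1 - (j0 + j) = j1 + (w - 1 - j)" "msize G n - 1 - (i0 + i) = i1 + (h - 1 - i)"
    using ij assms(1,2) by auto
  then show "block i0 j0 h w (form_adjoint G n X) $$ (i, j) =
      (c \<cdot>\<^sub>m antitranspose (block j1 i1 w h X)) $$ (i, j)"
    using ij assms(1,2) sign[OF ij]
    by (simp add: block_index form_adjoint_index antitranspose_index)
qed auto


text \<open>The block rows of \<open>X\<close> are \<open>(A, B, C)\<close>,
  \<open>(0, 1, E)\<close>, \<open>(0, 0, Z)\<close>. Writing \<open>'\<close> for the antitranspose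
  and \<open>c\<close> for the corner sign, those of the adjoint are \<open>(Z', E', c C')\<close>,
  \<open>(0, 1, B')\<close>, \<open>(0, 0, A')\<close>. The five equations are the blocks of the
  product on and above the diagonal, apart from the middle one, which reads
  \<open>1 = 1\<close>.\<close>

lemma isometry_blocks:
  fixes X :: "'a::field mat"
  assumes X: "X \<in> carrier_mat (msize G n) (msize G n)"
    and lower: "block n 0 (middle G) n X = 0\<^sub>m (middle G) n" "block (n + middle G) 0 n n X = 0\<^sub>m n n"
      "block (n + middle G) n n (middle G) X = 0\<^sub>m n (middle G)"
    and mid: "block n n (middle G) (middle G) X = 1\<^sub>m (middle G)"
    and A: "A = block 0 0 n n X" and B: "B = block 0 n n (middle G) X"
    and C: "C = block 0 (n + middle G) n n X" and E: "E = block n (n + middle G) (middle G) n X"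
    and Z: "Z = block (n + middle G) (n + middle G) n n X"
  shows "form_adjoint G n X * X = 1\<^sub>m (msize G n) \<longleftrightarrow>
    antitranspose Z * A = 1\<^sub>m n \<and>
    antitranspose Z * B + antitranspose E = 0\<^sub>m n (middle G) \<and>
    antitranspose Z * C + antitranspose E * E + corner_sign G \<cdot>\<^sub>m (antitranspose C * Z) = 0\<^sub>m n n \<and>
    E + antitranspose B * Z = 0\<^sub>m (middle G) n \<and>
    antitranspose A * Z = 1\<^sub>m n" (is "?iso \<longleftrightarrow> ?eqs")
proof -
  let ?r = "middle G" and ?m = "msize G n" and ?\<sigma>X = "form_adjoint G n X"
  have m: "?m = n + ?r + n"
    by (simp add: msize_def)
  have \<sigma>: "block i0 j0 h w ?\<sigma>X = c \<cdot>\<^sub>m antitranspose (block j1 i1 w h X)"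
    if "i0 + h + i1 = ?m" "j0 + w + j1 = ?m"
      "\<And>i j. i < h \<Longrightarrow> j < w \<Longrightarrow> form_sign G n (i0 + i) * form_sign G n (j0 + j) = (c :: 'a)"
    for i0 h i1 j0 w j1 c
    using block_form_adjoint[OF that] .
  have antitranspose_zero: "antitranspose (0\<^sub>m h w :: 'a mat) = 0\<^sub>m w h" for h w
    by (rule eq_matI) (auto simp: antitranspose_index)
  have one_smult: "1 \<cdot>\<^sub>m M = M" for M :: "'a mat"
    by (rule eq_matI) auto
  \<comment> \<open>For \<open>Sp\<close> the blocks touching the middle are empty, so the sign 1 is
    correct for them in every family.\<close>
  have Sp_0: "G = Sp \<Longrightarrow> ?r = 0"
    by simp
  have s0: "block 0 0 n n ?\<sigma>X = antitranspose Z"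
    using lower mid Sp_0 unfolding A B C E Z
    by (subst \<sigma>[where c = "1" and ?i1.0 = "n + ?r" and ?j1.0 = "n + ?r"])
      (auto simp: m form_sign_def corner_sign_def one_smult antitranspose_zero antitranspose_one)
  have s1: "block 0 n n ?r ?\<sigma>X = antitranspose E"
    using lower mid Sp_0 unfolding A B C E Z
    by (subst \<sigma>[where c = "1" and ?i1.0 = "n + ?r" and ?j1.0 = "n"])
      (auto simp: m form_sign_def corner_sign_def one_smult antitranspose_zero antitranspose_one)
  have s2: "block 0 (n + ?r) n n ?\<sigma>X = corner_sign G \<cdot>\<^sub>m antitranspose C"
    using lower mid Sp_0 unfolding A B C E Z
    by (subst \<sigma>[where c = "corner_sign G" and ?i1.0 = "n + ?r" and ?j1.0 = "0"])
      (auto simp: m form_sign_def corner_sign_def one_smult antitranspose_zero antitranspose_one)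
  have s3: "block n 0 ?r n ?\<sigma>X = 0\<^sub>m ?r n"
    using lower mid Sp_0 unfolding A B C E Z
    by (subst \<sigma>[where c = "1" and ?i1.0 = "n" and ?j1.0 = "n + ?r"])
      (auto simp: m form_sign_def corner_sign_def one_smult antitranspose_zero antitranspose_one)
  have s4: "block n n ?r ?r ?\<sigma>X = 1\<^sub>m ?r"
    using lower mid Sp_0 unfolding A B C E Z
    by (subst \<sigma>[where c = "1" and ?i1.0 = "n" and ?j1.0 = "n"])
      (auto simp: m form_sign_def corner_sign_def one_smult antitranspose_zero antitranspose_one)
  have s5: "block n (n + ?r) ?r n ?\<sigma>X = antitranspose B"
    using lower mid Sp_0 unfolding A B C E Z
    by (subst \<sigma>[where c = "1" and ?i1.0 = "n" and ?j1.0 = "0"])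
      (auto simp: m form_sign_def corner_sign_def one_smult antitranspose_zero antitranspose_one)
  have s6: "block (n + ?r) 0 n n ?\<sigma>X = 0\<^sub>m n n"
    using lower mid Sp_0 unfolding A B C E Z
    by (subst \<sigma>[where c = "corner_sign G" and ?i1.0 = "0" and ?j1.0 = "n + ?r"])
      (auto simp: m form_sign_def corner_sign_def one_smult antitranspose_zero antitranspose_one)
  have s7: "block (n + ?r) n n ?r ?\<sigma>X = 0\<^sub>m n ?r"
    using lower mid Sp_0 unfolding A B C E Z
    by (subst \<sigma>[where c = "1" and ?i1.0 = "0" and ?j1.0 = "n"])
      (auto simp: m form_sign_def corner_sign_def one_smult antitranspose_zero antitranspose_one)
  have s8: "block (n + ?r) (n + ?r) n n ?\<sigma>X = antitranspose A"
    using lower mid Sp_0 unfolding A B C E Z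
    by (subst \<sigma>[where c = "1" and ?i1.0 = "0" and ?j1.0 = "0"])
      (auto simp: m form_sign_def corner_sign_def one_smult antitranspose_zero antitranspose_one)
  note \<sigma>_blocks = s0 s1 s2 s3 s4 s5 s6 s7 s8
  have zero_add: "0\<^sub>m h k + M = M" and add_zero: "M + 0\<^sub>m h k = M"
    if "dim_row M = h" "dim_col M = k" for M :: "'a mat" and h k
    using that by (auto intro!: eq_matI)
  have blocks: "?iso \<longleftrightarrow> (\<forall>(i0, h) \<in> {(0, n), (n, ?r), (n + ?r, n)}. \<forall>(j0, w) \<in> {(0, n), (n, ?r), (n + ?r, n)}.
      block i0 j0 h w (?\<sigma>X * X) = block i0 j0 h w (1\<^sub>m ?m))"
    using block_eqI[of "?\<sigma>X * X" n ?r "1\<^sub>m ?m"] X form_adjoint_carrier[of G n X]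
    by (auto simp: m)
  have [simp]: "dim_row A = n" "dim_col A = n" "dim_row B = n" "dim_col B = ?r"
    "dim_row C = n" "dim_col C = n" "dim_row E = ?r" "dim_col E = n" "dim_row Z = n" "dim_col Z = n"
    by (simp_all add: A B C E Z)
  show ?thesis
    unfolding blocks
    using X form_adjoint_carrier[of G n X] lower mid
    by (simp add: m block_mult \<sigma>_blocks block_one block_one_offdiagonal mat_algebra
        zero_add add_zero flip: A B C E Z)
qed

lemma antitranspose_unitriangular:
  assumes A: "A \<in> unitriangular k"
  shows "antitranspose A \<in> unitriangular k"
  using unitriangularD[OF A]
  by (intro unitriangularI) (auto simp: antitranspose_index intro: carrier_matI)

section \<open>The explicit block matrices of the group\<close>

lemma U_block_dim [simp]:
  assumes "x \<in> carrier_mat n n" "y \<in> carrier_mat n n"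
  shows "dim_row (U_block n r x y v w) = n + r + n" "dim_col (U_block n r x y v w) = n + r + n"
  using assms by (simp_all add: U_block_def)

lemma U_block_index:
  fixes x y v w :: "'a::field mat"
  assumes "x \<in> carrier_mat n n" "y \<in> carrier_mat n n" "v \<in> carrier_mat n r" "w \<in> carrier_mat n n"
    and "r \<le> 1" "i < n + r + n" "j < n + r + n"
  shows "U_block n r x y v w $$ (i, j) =
    (if i < n then
       if j < n then x $$ (i, j) else if j < n + r then (x * v) $$ (i, j - n)
       else (x * w) $$ (i, j - (n + r))
     else if i < n + r then
       if j < n then 0 else if j < n + r then 1\<^sub>m r $$ (i - n, j - n)
       else (- antitranspose v) $$ (i - n, j - (n + r))
     else if j < n + r then 0 else antitranspose y $$ (i - (n + r), j - (n + r)))"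
  using assms
  unfolding U_block_def antidiag_transpose_antidiag[OF assms(2)]
    transpose_antidiag_thin[OF assms(3,5)] append_rows_def
  by (auto simp del: index_mult_mat(1) index_one_mat(1) index_uminus_mat(1))

lemma U_block_blocks:
  fixes x y v w :: "'a::field mat"
  assumes "x \<in> carrier_mat n n" "y \<in> carrier_mat n n" "v \<in> carrier_mat n r" "w \<in> carrier_mat n n"
    and "r \<le> 1"
  defines "X \<equiv> U_block n r x y v w"
  shows "block 0 0 n n X = x" "block 0 n n r X = x * v" "block 0 (n + r) n n X = x * w"
    "block n 0 r n X = 0\<^sub>m r n" "block n n r r X = 1\<^sub>m r" "block n (n + r) r n X = - antitranspose v"
    "block (n + r) 0 n n X = 0\<^sub>m n n" "block (n + r) n n r X = 0\<^sub>m n r"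
    "block (n + r) (n + r) n n X = antitranspose y"
  unfolding X_def using assms(1-4)
  by (intro eq_matI;
      auto simp: block_index U_block_index[OF assms(1-5)]
        simp del: index_mult_mat(1) index_one_mat(1) index_uminus_mat(1))+

lemma U_block_unitriangular:
  fixes x y v w :: "'a::field mat"
  assumes "x \<in> unitriangular n" "y \<in> unitriangular n" "v \<in> carrier_mat n r" "w \<in> carrier_mat n n"
    and "r \<le> 1"
  shows "U_block n r x y v w \<in> unitriangular (n + r + n)"
proof (rule unitriangularI)
  note carriers = unitriangular_carrier[OF assms(1)] unitriangular_carrier[OF assms(2)] assms(3,4)
  note entry = U_block_index[OF carriers assms(5)]
  note y' = antitranspose_unitriangular[OF assms(2)]
  show "U_block n r x y v w \<in> carrier_mat (n + r + n) (n + r + n)"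
    using carriers by (intro carrier_matI) auto
  show "U_block n r x y v w $$ (i, j) = 0" if "j < i" "i < n + r + n" for i j
    using that unitriangular_below[OF assms(1), of j i]
      unitriangular_below[OF y', of "j - (n + r)" "i - (n + r)"]
    by (simp add: entry; linarith)
  show "U_block n r x y v w $$ (i, i) = 1" if "i < n + r + n" for i
    using that unitriangular_diag[OF assms(1), of i] unitriangular_diag[OF y', of "i - (n + r)"]
    by (simp add: entry; linarith)
qed

text \<open>For a matrix in block form the five equations of \<open>isometry_blocks\<close> reduce
  to \<open>w_condition\<close>. Conversely, they determine the parameters of an isometry:
  \<open>x\<close> is its upper left block, and \<open>y\<close>, \<open>v\<close>, \<open>w\<close>
  are read off from the remaining ones.\<close>

lemma U_group_eq_isometries:
  "U_group G n =
    {X \<in> unitriangular (msize G n). form_adjoint G n X * X = (1\<^sub>m (msize G n) :: 'a::{field,finite} mat)}"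
proof (intro subset_antisym subsetI)
  let ?r = "middle G" and ?m = "msize G n" and ?c = "corner_sign G :: 'a"
  have m: "?m = n + ?r + n"
    by (simp add: msize_def)
  fix X :: "'a mat"
  assume "X \<in> U_group G n"
  then obtain x y v w where X: "X = U_block n ?r x y v w"
    and x: "x \<in> unitriangular n" and y: "y \<in> carrier_mat n n" "inverts_mat x y" "inverts_mat y x"
    and v: "v \<in> carrier_mat n ?r" and w: "w \<in> carrier_mat n n" and wc: "w_condition G n v w"
    by (auto simp: U_group_def)
  have [simp]: "dim_row x = n" "dim_col x = n" "dim_row y = n" "dim_col y = n" "dim_row v = n"
    "dim_col v = ?r" "dim_row w = n" "dim_col w = n"
    using unitriangularD[OF x] y v w by auto
  have xy: "x * y = 1\<^sub>m n" "y * x = 1\<^sub>m n"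
    using y by (auto simp: inverts_mat_def)
  obtain y' where y': "y' \<in> unitriangular n" "x * y' = 1\<^sub>m n"
    using unitriangular_inverse[OF x] by metis
  \<comment> \<open>The given inverse of \<open>x\<close> agrees with the unitriangular one, so the
    lower right block is unitriangular as well.\<close>
  have "y = y * (x * y')"
    by (simp add: y' mat_mult_one)
  also have "\<dots> = y'"
    using unitriangularD[OF y'(1)] by (simp add: mat_cancel_left[OF xy(2)])
  finally have y_T: "y \<in> unitriangular n"
    using y' by simp
  have X_T: "X \<in> unitriangular ?m"
    unfolding X m using U_block_unitriangular[OF x y_T v w middle_le_1] .
  note blocks = U_block_blocks[OF unitriangular_carrier[OF x] y(1) v w middle_le_1, folded X]
  have yx: "antitranspose x * antitranspose y = 1\<^sub>m n"
    by (simp add: xy antitranspose_one flip: antitranspose_mult)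
  have v': "antitranspose v \<in> carrier_mat ?r n"
    by (intro carrier_matI) simp_all
  have "form_adjoint G n X * X = 1\<^sub>m ?m"
    using wc[unfolded w_condition_antitranspose[OF v w]]
    unfolding isometry_blocks[OF unitriangular_carrier[OF X_T] blocks(4,7,8,5) refl refl refl refl refl]
      blocks
    by (simp add: antitranspose_involution antitranspose_mult antitranspose_uminus mat_algebra
        mat_cancel_left[OF xy(2)] xy yx add_uminus_minus_mat[OF v v] minus_r_inv_mat[OF v]
        uminus_l_inv_mat[OF v'])
  with X_T show "X \<in> {X \<in> unitriangular ?m. form_adjoint G n X * X = 1\<^sub>m ?m}"
    by simp
next
  let ?r = "middle G" and ?m = "msize G n" and ?c = "corner_sign G :: 'a"
  have m: "?m = n + ?r + n"
    by (simp add: msize_def)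
  fix X :: "'a mat"
  assume "X \<in> {X \<in> unitriangular ?m. form_adjoint G n X * X = 1\<^sub>m ?m}"
  then have X: "X \<in> unitriangular ?m" and iso: "form_adjoint G n X * X = 1\<^sub>m ?m"
    by auto
  have lower: "block n 0 ?r n X = 0\<^sub>m ?r n" "block (n + ?r) 0 n n X = 0\<^sub>m n n"
      "block (n + ?r) n n ?r X = 0\<^sub>m n ?r"
    using unitriangularD[OF X] by (auto simp: m block_index intro!: eq_matI)
  \<comment> \<open>The middle block has size at most 1, so a unit diagonal already makes it the
    identity.\<close>
  have mid: "block n n ?r ?r X = 1\<^sub>m ?r"
    using unitriangularD[OF X]
    by (cases G) (auto simp: msize_def block_index intro!: eq_matI)
  define A B C E Z where "A = block 0 0 n n X" and "B = block 0 n n ?r X"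
    and "C = block 0 (n + ?r) n n X" and "E = block n (n + ?r) ?r n X"
    and "Z = block (n + ?r) (n + ?r) n n X"
  note eqs = iso[unfolded isometry_blocks[OF unitriangular_carrier[OF X] lower mid
        A_def B_def C_def E_def Z_def]]
  have [simp]: "dim_row A = n" "dim_col A = n" "dim_row B = n" "dim_col B = ?r"
    "dim_row C = n" "dim_col C = n" "dim_row E = ?r" "dim_col E = n" "dim_row Z = n" "dim_col Z = n"
    by (simp_all add: A_def B_def C_def E_def Z_def)
  \<comment> \<open>The first block equation makes \<open>antitranspose Z\<close> the inverse of
    \<open>A\<close>; multiplying by it removes the factor \<open>x\<close> from the blocks
    \<open>xv\<close> and \<open>xw\<close>.\<close>
  define y v w where "y = antitranspose Z" and "v = y * B" and "w = y * C"
  have [simp]: "dim_row y = n" "dim_col y = n" "dim_row v = n" "dim_col v = ?r" "dim_row w = n"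
    "dim_col w = n"
    by (simp_all add: y_def v_def w_def)
  have A: "A \<in> unitriangular n"
    using unitriangularD[OF X] unfolding A_def
    by (intro unitriangularI) (auto simp: m block_index intro: carrier_matI)
  have yA: "y * A = 1\<^sub>m n"
    using eqs by (simp add: y_def)
  have Ay: "A * y = 1\<^sub>m n"
    by (rule mat_mult_left_right_inverse[OF _ _ yA]) (auto intro: carrier_matI)
  have v: "v \<in> carrier_mat n ?r" and w: "w \<in> carrier_mat n n" and y: "y \<in> carrier_mat n n"
    by (auto intro: carrier_matI)
  have AvB: "A * v = B" and AwC: "A * w = C"
    by (simp_all add: v_def w_def mat_cancel_left[OF Ay])
  have E: "antitranspose E = - v"
  proof (rule eq_matI)
    fix i j assume ij: "i < dim_row (- v)" "j < dim_col (- v)"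
    have "v + antitranspose E = 0\<^sub>m n ?r"
      using eqs by (simp add: y_def v_def)
    from arg_cong[OF this, of "\<lambda>M. M $$ (i, j)"] ij
    show "antitranspose E $$ (i, j) = (- v) $$ (i, j)"
      by (simp add: eq_neg_iff_add_eq_0 add.commute)
  qed auto
  have E_v: "E = - antitranspose v"
    using arg_cong[OF E, of antitranspose]
    by (simp add: antitranspose_involution antitranspose_uminus)
  have Z_y: "Z = antitranspose y"
    by (simp add: y_def antitranspose_involution)
  have "w + v * antitranspose v + ?c \<cdot>\<^sub>m antitranspose w = 0\<^sub>m n n"
  proof -
    \<comment> \<open>With \<open>C = A * w\<close> and \<open>antitranspose A * Z = 1\<close>, the
      last summand of the corner equation loses its dependence on \<open>A\<close>.\<close>
    have "antitranspose C * Z = antitranspose w * (antitranspose A * Z)"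
      unfolding AwC[symmetric] by (simp add: antitranspose_mult mat_algebra)
    also have "\<dots> = antitranspose w"
      using eqs by (simp add: mat_algebra)
    finally have CZ: "antitranspose C * Z = antitranspose w" .
    have "antitranspose Z * C = w"
      by (simp add: y_def w_def)
    moreover have "antitranspose E * E = v * antitranspose v"
      unfolding E unfolding E_v by simp
    ultimately show ?thesis
      using eqs CZ by simp
  qed
  then have wc: "w_condition G n v w"
    using w_condition_antitranspose[OF v w] by simp
  note blocks = U_block_blocks[OF unitriangular_carrier[OF A] y v w middle_le_1]
  have "X = U_block n ?r A y v w"
  proof (rule block_eqI)
    show "X \<in> carrier_mat (n + ?r + n) (n + ?r + n)"
      using unitriangular_carrier[OF X] by (simp add: m)
    show "U_block n ?r A y v w \<in> carrier_mat (n + ?r + n) (n + ?r + n)"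
      using unitriangular_carrier[OF A] y by (intro carrier_matI) auto
    show "block i0 j0 h k X = block i0 j0 h k (U_block n ?r A y v w)"
      if "(i0, h) \<in> {(0, n), (n, ?r), (n + ?r, n)}" "(j0, k) \<in> {(0, n), (n, ?r), (n + ?r, n)}"
      for i0 h j0 k
      using that blocks lower mid AvB AwC E_v Z_y
      by (elim insertE emptyE)
        (auto simp: A_def[symmetric] B_def[symmetric] C_def[symmetric] E_def[symmetric] Z_def[symmetric])
  qed
  moreover have "inverts_mat A y" "inverts_mat y A"
    using Ay yA by (simp_all add: inverts_mat_def)
  ultimately show "X \<in> U_group G n"
    using A y v w wc unfolding U_group_def by blast
qed

section \<open>Products of superclasses\<close>

lemma superclass_iff:
  fixes x :: "'a::{field,finite} mat"
  shows "x \<in> superclass G n D \<phi> \<longleftrightarrow>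
    x \<in> unitriangular (msize G n) \<and> form_adjoint G n x * x = 1\<^sub>m (msize G n) \<and>
    x - 1\<^sub>m (msize G n) \<in> V_set G n D \<phi>"
  by (auto simp: superclass_def U_group_eq_isometries)

lemma V_setI:
  "A \<in> unitriangular (msize G n) \<Longrightarrow> B \<in> unitriangular (msize G n) \<Longrightarrow>
    A * e_mat G n D \<phi> * B \<in> V_set G n D \<phi>"
  by (auto simp: V_set_def)

lemma V_set_mult_left:
  fixes z :: "'a::field mat"
  assumes "z \<in> V_set G n D \<phi>" "u \<in> unitriangular (msize G n)"
  shows "u * z \<in> V_set G n D \<phi>"
proof -
  obtain A B where AB: "A \<in> unitriangular (msize G n)" "B \<in> unitriangular (msize G n)"
    "z = A * e_mat G n D \<phi> * B"
    using assms(1) by (auto simp: V_set_def)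
  then have "u * z = (u * A) * e_mat G n D \<phi> * B"
    using unitriangularD(2,3)[OF AB(1)] unitriangularD(2,3)[OF AB(2)] unitriangularD(2,3)[OF assms(2)]
    by (simp add: mat_mult_assoc)
  then show ?thesis
    using AB assms(2) by (auto intro!: V_setI mult_unitriangular)
qed

text \<open>The two sums involve different unitriangular factors; basicness allows them to be merged
  into one pair by \<open>unitriangular_sum_of_disjoint\<close>.\<close>

lemma V_set_add:
  fixes y z :: "'a::field mat"
  assumes "finite D" "\<alpha> \<notin> D" "basic G n (insert \<alpha> D)"
    and y: "y \<in> V_set G n {\<alpha>} (\<lambda>_. \<phi> \<alpha>)" and z: "z \<in> V_set G n D \<phi>"
  shows "y + z \<in> V_set G n (insert \<alpha> D) \<phi>"
proof -
  let ?e1 = "e_mat G n {\<alpha>} (\<lambda>_. \<phi> \<alpha>)" and ?e2 = "e_mat G n D \<phi>"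
  obtain a b where ab: "a \<in> unitriangular (msize G n)" "b \<in> unitriangular (msize G n)" "y = a * ?e1 * b"
    using y by (auto simp: V_set_def)
  obtain c d where cd: "c \<in> unitriangular (msize G n)" "d \<in> unitriangular (msize G n)" "z = c * ?e2 * d"
    using z by (auto simp: V_set_def)
  obtain u w where "u \<in> unitriangular (msize G n)" "w \<in> unitriangular (msize G n)"
    "y + z = u * (?e1 + ?e2) * w"
    unfolding ab(3) cd(3)
    by (rule unitriangular_sum_of_disjoint[of ?e1 "msize G n" ?e2 a b c d,
          OF e_mat_carrier e_mat_carrier _ _ ab(1,2) cd(1,2)])
      (use e_mat_disjoint_supports[OF assms(3,2)] in blast)+
  then show ?thesis
    unfolding e_mat_insert[OF assms(1,2), symmetric] by (simp add: V_setI)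
qed

lemma superclass_empty: "superclass G n {} \<phi> = {1\<^sub>m (msize G n) :: 'a::{field,finite} mat}"
proof -
  let ?m = "msize G n" and ?O = "0\<^sub>m (msize G n) (msize G n) :: 'a mat"
  have "A * ?O * B = ?O" if "A \<in> unitriangular ?m" "B \<in> unitriangular ?m" for A B
    using unitriangular_carrier[OF that(1)] unitriangular_carrier[OF that(2)] by simp
  moreover have "1\<^sub>m ?m * e_mat G n {} \<phi> * 1\<^sub>m ?m \<in> V_set G n {} \<phi>"
    by (intro V_setI one_unitriangular)
  ultimately have V: "V_set G n {} \<phi> = {?O}"
    by (auto simp: V_set_def e_mat_empty)
  have "x - 1\<^sub>m ?m = ?O \<longleftrightarrow> x = 1\<^sub>m ?m" if "x \<in> unitriangular ?m" for x
    using unitriangularD(2,3)[OF that] by (auto simp: mat_eq_iff)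
  then show ?thesis
    using one_unitriangular by (auto simp: superclass_iff V form_adjoint_one)
qed

text \<open>Any root of a basic set can play the role of \<open>\<alpha>\<close>, which is the
  source of the freedom in the order of the product. The new factor stands on the left, as
  \<open>foldr\<close> in \<open>set_product\<close> requires.\<close>

lemma superclass_insert:
  fixes \<phi> :: "eps_root \<Rightarrow> 'a::{field,finite}"
  assumes two: "(2 :: 'a) \<noteq> 0" and D: "finite D" "\<alpha> \<notin> D" and basic: "basic G n (insert \<alpha> D)"
  shows "superclass G n (insert \<alpha> D) \<phi> = root_superclass G n \<alpha> (\<phi> \<alpha>) * superclass G n D \<phi>"
proof (intro subset_antisym subsetI)
  let ?m = "msize G n" and ?\<sigma> = "form_adjoint G n"
  let ?e1 = "e_mat G n {\<alpha>} (\<lambda>_. \<phi> \<alpha>)" and ?e2 = "e_mat G n D \<phi>"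
  have roots: "{\<alpha>} \<subseteq> roots G n" "D \<subseteq> roots G n"
    using basic by (auto simp: basic_def)
  fix x assume "x \<in> superclass G n (insert \<alpha> D) \<phi>"
  then have x: "x \<in> unitriangular ?m" "?\<sigma> x * x = 1\<^sub>m ?m"
    and "x - 1\<^sub>m ?m \<in> V_set G n (insert \<alpha> D) \<phi>"
    by (auto simp: superclass_iff)
  then obtain a b where ab: "a \<in> unitriangular ?m" "b \<in> unitriangular ?m"
    "x - 1\<^sub>m ?m = a * (?e1 + ?e2) * b"
    unfolding V_set_def e_mat_insert[OF D] by blast
  obtain y a1 b1 a2 b2 where y: "y \<in> unitriangular ?m" "?\<sigma> y * y = 1\<^sub>m ?m"
    and units: "{a1, b1, a2, b2} \<subseteq> unitriangular ?m"
    and y1: "y - 1\<^sub>m ?m = a1 * ?e1 * b1" and y2: "?\<sigma> y * x - 1\<^sub>m ?m = a2 * ?e2 * b2"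
    using isometry_splitting[OF two x ab e_mat_carrier form_adjoint_e_mat[OF roots(1)]
        e_mat_strictly_upper[OF roots(1)] e_mat_carrier form_adjoint_e_mat[OF roots(2)]] by metis
  have \<sigma>y: "?\<sigma> y \<in> unitriangular ?m"
    by (rule form_adjoint_unitriangular[OF y(1)])
  have y\<sigma>: "y * ?\<sigma> y = 1\<^sub>m ?m"
    using mat_mult_left_right_inverse[OF form_adjoint_carrier unitriangular_carrier[OF y(1)] y(2)] .
  note [simp] = unitriangularD(2,3)[OF x(1)] unitriangularD(2,3)[OF y(1)]
  have "y \<in> root_superclass G n \<alpha> (\<phi> \<alpha>)"
    unfolding root_superclass_def superclass_iff y1 using y units by (auto intro: V_setI)
  moreover have "?\<sigma> y * x \<in> superclass G n D \<phi>"
    unfolding superclass_iff y2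
  proof (intro conjI)
    show "?\<sigma> y * x \<in> unitriangular ?m"
      by (rule mult_unitriangular[OF \<sigma>y x(1)])
    show "a2 * ?e2 * b2 \<in> V_set G n D \<phi>"
      using units by (auto intro: V_setI)
    \<comment> \<open>The inner \<open>y * ?\<sigma> y\<close> cancels, leaving the isometry
      equation of \<open>x\<close>.\<close>
    have "?\<sigma> (?\<sigma> y * x) * (?\<sigma> y * x) = ?\<sigma> x * (y * (?\<sigma> y * x))"
      using unitriangular_carrier[OF x(1)] unitriangular_carrier[OF y(1)] form_adjoint_carrier
      by (simp add: form_adjoint_mult[of _ G n] form_adjoint_involution mat_mult_assoc carrier_matI)
    then show "?\<sigma> (?\<sigma> y * x) * (?\<sigma> y * x) = 1\<^sub>m ?m"
      by (simp add: mat_cancel_left[OF y\<sigma>] x)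
  qed
  moreover have "x = y * (?\<sigma> y * x)"
    by (simp add: mat_cancel_left[OF y\<sigma>])
  ultimately show "x \<in> root_superclass G n \<alpha> (\<phi> \<alpha>) * superclass G n D \<phi>"
    by (metis set_times_intro)
next
  let ?m = "msize G n" and ?\<sigma> = "form_adjoint G n"
  fix x assume "x \<in> root_superclass G n \<alpha> (\<phi> \<alpha>) * superclass G n D \<phi>"
  then obtain y z where x: "x = y * z" and "y \<in> root_superclass G n \<alpha> (\<phi> \<alpha>)" "z \<in> superclass G n D \<phi>"
    by (auto elim: set_times_elim)
  then have y: "y \<in> unitriangular ?m" "?\<sigma> y * y = 1\<^sub>m ?m"
      "y - 1\<^sub>m ?m \<in> V_set G n {\<alpha>} (\<lambda>_. \<phi> \<alpha>)"
    and z: "z \<in> unitriangular ?m" "?\<sigma> z * z = 1\<^sub>m ?m" "z - 1\<^sub>m ?m \<in> V_set G n D \<phi>"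
    by (auto simp: root_superclass_def superclass_iff)
  note [simp] = unitriangularD(2,3)[OF y(1)] unitriangularD(2,3)[OF z(1)]
  have "y * z \<in> unitriangular ?m"
    by (rule mult_unitriangular[OF y(1) z(1)])
  moreover have "?\<sigma> (y * z) * (y * z) = 1\<^sub>m ?m"
    using unitriangular_carrier[OF y(1)] unitriangular_carrier[OF z(1)]
    by (simp add: form_adjoint_mult mat_mult_assoc mat_cancel_left[OF y(2)] z(2))
  \<comment> \<open>By \<open>V_set_mult_left\<close> the factor \<open>y\<close> keeps the second
    summand in \<open>V_set G n D \<phi>\<close>, so \<open>V_set_add\<close> applies.\<close>
  moreover have "y * z - 1\<^sub>m ?m = (y - 1\<^sub>m ?m) + y * (z - 1\<^sub>m ?m)"
    by (simp add: mat_algebra) (rule eq_matI; simp del: index_mult_mat(1))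
  then have "y * z - 1\<^sub>m ?m \<in> V_set G n (insert \<alpha> D) \<phi>"
    using V_set_add[OF D basic y(3) V_set_mult_left[OF z(3) y(1)]] by simp
  ultimately show "x \<in> superclass G n (insert \<alpha> D) \<phi>"
    unfolding x superclass_iff by blast
qed

theorem theorem5p4:
  fixes p e n :: nat
    and G :: family
    and D :: "eps_root set"
    and \<phi> :: "eps_root \<Rightarrow> 'a::{field,finite}"
    and \<alpha>s :: "eps_root list"
  assumes "prime p" and "odd p" and "e \<ge> 1" and "CARD('a) = p ^ e"
    and "n \<ge> 1"
    and "basic_pair G n D \<phi>"
    and "distinct \<alpha>s" and "set \<alpha>s = D"
  shows "superclass G n D \<phi> =
    set_product (msize G n) (map (\<lambda>\<alpha>. root_superclass G n \<alpha> (\<phi> \<alpha>)) \<alpha>s)"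
proof -
  have "odd CARD('a)"
    using assms(2,4) by simp
  then have two: "(2 :: 'a) \<noteq> 0"
    by (rule two_neq_zero_of_odd_card)
  \<comment> \<open>The claim is proved for every duplicate-free list with basic set of elements, by
    splitting off the head; each order of the factors is one such list.\<close>
  have "superclass G n (set \<alpha>s) \<phi> =
      set_product (msize G n) (map (\<lambda>\<alpha>. root_superclass G n \<alpha> (\<phi> \<alpha>)) \<alpha>s)"
    if "distinct \<alpha>s" "basic G n (set \<alpha>s)" for \<alpha>s
    using that
  proof (induction \<alpha>s)
    case Nil
    then show ?case
      by (simp add: superclass_empty set_product_def)
  next
    case (Cons \<alpha> \<alpha>s)
    then have "basic G n (set \<alpha>s)"
      by (auto simp: basic_def intro: inj_on_subset)
    with Cons show ?case
      using superclass_insert[OF two, of "set \<alpha>s" \<alpha> G n \<phi>] by (simp add: set_product_def)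
  qed
  then show ?thesis
    using assms by (auto simp: basic_pair_def)
qed

end
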